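(* Let $T$ be a fixed closed Lipschitz subdomain of the unit ball $B_1\subset\mathbb{R}^3$, and for $\varepsilon\in(0,1)$ set $\Omega_\varepsilon:=B_1\setminus\varepsilon T$. Let $f\in L^p(B_1;\mathbb{R}^3)$ for some $p>3$ be such that $\operatorname{div} f\in L^q(B_1)$ for some $q>3/2$. Suppose that $f$ is independent of $\varepsilon$ and satisfies $$\int_{B_1}\Big(\frac1{|y|}-1\Big)\operatorname{div} f(y)\,dy\neq0 .$$ If for all sufficiently small $\varepsilon>0$ there exist solutions $u_\varepsilon\in W^{1,p}_0(\Omega_\varepsilon)$ to $$-\Delta u_\varepsilon=\operatorname{div} f\ \text{ in }\Omega_\varepsilon,\qquad u_\varepsilon=0\ \text{ on }\partial\Omega_\varepsilon=\partial B_1\cup\varepsilon\,\partial T,$$ then $$\liminf_{\varepsilon\to0}\|\nabla u_\varepsilon\|_{L^p(\Omega_\varepsilon)}=\infty .$$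
   Context: $B_1:=\{x\in\mathbb{R}^3:|x|<1\}$. $T\subset B_1$ is a closed subdomain with Lipschitz boundary, fixed and independent of $\varepsilon$. $\varepsilon T:=\{\varepsilon x: x\in T\}$. Solutions are weak solutions: $u_\varepsilon\in W^{1,p}_0(\Omega_\varepsilon)$ and $\int_{\Omega_\varepsilon}\nabla u_\varepsilon\cdot\nabla\phi\,dx=-\int_{\Omega_\varepsilon}f\cdot\nabla\phi\,dx$ for all $\phi\in C_c^\infty(\Omega_\varepsilon)$. $\operatorname{div} f$ is the distributional divergence. *)

theory Defs
  imports "HOL-Analysis.Analysis"
begin

subsection \<open>Test functions\<close>

primrec C_k :: "nat \<Rightarrow> ('a::real_normed_vector \<Rightarrow> real) \<Rightarrow> bool" where
  "C_k 0 \<phi> \<longleftrightarrow> continuous_on UNIV \<phi>"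
| "C_k (Suc k) \<phi> \<longleftrightarrow>
     (\<forall>x. \<phi> differentiable (at x)) \<and> (\<forall>v. C_k k (\<lambda>x. frechet_derivative \<phi> (at x) v))"

text \<open>The space \<open>C\<^sub>c\<^sup>\<infinity>(\<Omega>)\<close>; its elements are extended by zero to the whole space.\<close>

definition test_functions :: "'a::real_normed_vector set \<Rightarrow> ('a \<Rightarrow> real) set" where
  "test_functions \<Omega> =
     {\<phi>. (\<forall>k. C_k k \<phi>) \<and> compact (closure {x. \<phi> x \<noteq> 0}) \<and> closure {x. \<phi> x \<noteq> 0} \<subseteq> \<Omega>}"

definition grad :: "(real^'n \<Rightarrow> real) \<Rightarrow> real^'n \<Rightarrow> real^'n" where
  "grad \<phi> x = (\<chi> i. frechet_derivative \<phi> (at x) (axis i 1))"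


subsection \<open>Lebesgue and Sobolev spaces\<close>

text \<open>Functions are representatives defined on the whole space; only their values on \<open>\<Omega>\<close> matter.
  The exponent \<open>p\<close> is finite, and \<open>Lp_norm\<close> is meaningful for elements of \<open>Lp\<close> only.\<close>

definition Lp :: "real \<Rightarrow> 'a::euclidean_space set \<Rightarrow> ('a \<Rightarrow> 'b::euclidean_space) set" where
  "Lp p \<Omega> = {f. f \<in> borel_measurable (lebesgue_on \<Omega>) \<and>
                 integrable (lebesgue_on \<Omega>) (\<lambda>x. norm (f x) powr p)}"

definition Lp_norm :: "real \<Rightarrow> 'a::euclidean_space set \<Rightarrow> ('a \<Rightarrow> 'b::euclidean_space) \<Rightarrow> real" where
  "Lp_norm p \<Omega> f = (LINT x|lebesgue_on \<Omega>. norm (f x) powr p) powr (1 / p)"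

definition L1_loc :: "'a::euclidean_space set \<Rightarrow> ('a \<Rightarrow> 'b::euclidean_space) set" where
  "L1_loc \<Omega> = {f. \<forall>K. compact K \<and> K \<subseteq> \<Omega> \<longrightarrow> f absolutely_integrable_on K}"

definition has_weak_gradient ::
    "(real^'n) set \<Rightarrow> (real^'n \<Rightarrow> real) \<Rightarrow> (real^'n \<Rightarrow> real^'n) \<Rightarrow> bool" where
  "has_weak_gradient \<Omega> u g \<longleftrightarrow> u \<in> L1_loc \<Omega> \<and> g \<in> L1_loc \<Omega> \<and>
     (\<forall>\<phi>\<in>test_functions \<Omega>.
        (LINT x|lebesgue_on \<Omega>. u x *\<^sub>R grad \<phi> x) = - (LINT x|lebesgue_on \<Omega>. \<phi> x *\<^sub>R g x))"

text \<open>A representative of the weak gradient; on an open set it is unique up to null sets.\<close>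

definition weak_grad :: "(real^'n) set \<Rightarrow> (real^'n \<Rightarrow> real) \<Rightarrow> real^'n \<Rightarrow> real^'n" where
  "weak_grad \<Omega> u = (SOME g. has_weak_gradient \<Omega> u g)"

definition has_distributional_divergence ::
    "(real^'n) set \<Rightarrow> (real^'n \<Rightarrow> real^'n) \<Rightarrow> (real^'n \<Rightarrow> real) \<Rightarrow> bool" where
  "has_distributional_divergence \<Omega> f d \<longleftrightarrow> f \<in> L1_loc \<Omega> \<and> d \<in> L1_loc \<Omega> \<and>
     (\<forall>\<phi>\<in>test_functions \<Omega>.
        (LINT x|lebesgue_on \<Omega>. f x \<bullet> grad \<phi> x) = - (LINT x|lebesgue_on \<Omega>. d x * \<phi> x))"

definition W1p :: "real \<Rightarrow> (real^'n) set \<Rightarrow> (real^'n \<Rightarrow> real) set" where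
  "W1p p \<Omega> = {u \<in> Lp p \<Omega>. \<exists>g\<in>Lp p \<Omega>. has_weak_gradient \<Omega> u g}"

text \<open>The closure of \<open>C\<^sub>c\<^sup>\<infinity>(\<Omega>)\<close> in \<open>W\<^sup>1\<^sup>,\<^sup>p(\<Omega>)\<close>.\<close>

definition W1p_0 :: "real \<Rightarrow> (real^'n) set \<Rightarrow> (real^'n \<Rightarrow> real) set" where
  "W1p_0 p \<Omega> = {u \<in> W1p p \<Omega>. \<exists>\<phi>. (\<forall>n. \<phi> n \<in> test_functions \<Omega>) \<and>
     (\<lambda>n. Lp_norm p \<Omega> (\<lambda>x. \<phi> n x - u x)) \<longlonglongrightarrow> 0 \<and>
     (\<lambda>n. Lp_norm p \<Omega> (\<lambda>x. grad (\<phi> n) x - weak_grad \<Omega> u x)) \<longlonglongrightarrow> 0}"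


subsection \<open>Domains\<close>

text \<open>Near each boundary point, \<open>U\<close> is the region above the graph of a Lipschitz function
  over the hyperplane orthogonal to a unit vector \<open>e\<close>, with \<open>e\<close> pointing into \<open>U\<close>.\<close>

definition Lipschitz_boundary :: "'a::euclidean_space set \<Rightarrow> bool" where
  "Lipschitz_boundary U \<longleftrightarrow> (\<forall>x\<in>frontier U. \<exists>r>0. \<exists>e \<gamma> L. norm e = 1 \<and>
     L-lipschitz_on {z. e \<bullet> z = 0} \<gamma> \<and>
     U \<inter> ball x r = {y \<in> ball x r. e \<bullet> y > \<gamma> (y - (e \<bullet> y) *\<^sub>R e)})"

definition closed_Lipschitz_domain :: "'a::euclidean_space set \<Rightarrow> bool" where
  "closed_Lipschitz_domain T \<longleftrightarrow>
     (\<exists>U. open U \<and> connected U \<and> U \<noteq> {} \<and> Lipschitz_boundary U \<and> T = closure U)"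

definition perforated_ball :: "(real^3) set \<Rightarrow> real \<Rightarrow> (real^3) set" where
  "perforated_ball T \<epsilon> = ball 0 1 - (\<lambda>x. \<epsilon> *\<^sub>R x) ` T"


subsection \<open>The Dirichlet problem\<close>

text \<open>Weak solutions of \<open>- \<Delta> u = div f\<close> in \<open>\<Omega>\<close>, \<open>u = 0\<close> on the boundary.\<close>

definition weak_solution ::
    "real \<Rightarrow> (real^'n) set \<Rightarrow> (real^'n \<Rightarrow> real^'n) \<Rightarrow> (real^'n \<Rightarrow> real) \<Rightarrow> bool" where
  "weak_solution p \<Omega> f u \<longleftrightarrow> u \<in> W1p_0 p \<Omega> \<and>
     (\<forall>\<phi>\<in>test_functions \<Omega>.
        (LINT x|lebesgue_on \<Omega>. weak_grad \<Omega> u x \<bullet> grad \<phi> x) =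
        - (LINT x|lebesgue_on \<Omega>. f x \<bullet> grad \<phi> x))"

end

theory Submission
  imports Defs
begin

text \<open>Let \<open>G(y) = 1/|y| - 1\<close> and let \<open>x\<close> be a point of the hole \<open>\<epsilon>T\<close>. A function \<open>\<psi> \<in> C\<^sub>c\<^sup>\<infinity>(\<Omega>\<^sub>\<epsilon>)\<close>
  vanishes at \<open>x\<close>, so \<open>\<integral> \<nabla>\<psi> \<cdot> \<nabla>G(y - x) dy = 4\<pi> \<psi>(x) = 0\<close>; by density and Hoelder (as \<open>p > 3\<close>, \<open>\<nabla>G\<close> is in
  \<open>L\<^sup>r\<close> for the conjugate exponent \<open>r < 3/2\<close>) the same holds with \<open>\<psi>\<close> replaced by \<open>u\<^sub>\<epsilon>\<close>. Testing the equation with a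
  truncation \<open>\<phi>\<^sub>\<epsilon>\<close> of \<open>G(y - x)\<close> that vanishes near the hole and near the unit sphere gives
  \<open>\<integral> div f \<phi>\<^sub>\<epsilon> = \<integral> \<nabla>u\<^sub>\<epsilon> \<cdot> (\<nabla>\<phi>\<^sub>\<epsilon> - \<nabla>G(y - x)) \<le> \<parallel>\<nabla>u\<^sub>\<epsilon>\<parallel>\<^sub>p \<parallel>\<nabla>\<phi>\<^sub>\<epsilon> - \<nabla>G(y - x)\<parallel>\<^sub>r\<close>. The left-hand side tends to
  \<open>\<integral> G div f \<noteq> 0\<close> and the last factor tends to \<open>0\<close>, both by dominated convergence.\<close>

subsection \<open>Smooth functions\<close>

text \<open>G is 4 pi times the Green function of the unit ball with pole 0, so the hypothesis says
  that the solution in the unperforated ball does not vanish at 0. For p > 3 points have positive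
  capacity in W^{1,p}: the condition u = 0 on the shrinking hole survives in the limit, and bounded
  gradients would contradict it. Instead of extracting a weak limit, the proof uses a duality
  estimate whose error is explicit in \<epsilon>. The pole is \<open>\<epsilon> *\<^sub>R t\<close>
  for a fixed t in \<open>T\<close> rather than 0, because 0 may lie outside \<open>T\<close>. It
  moves with \<epsilon>, so every limit is taken after recentring. The identity with 4 pi \<psi>(x)
  is used only when \<psi>(x) = 0; in that case invariance under dilations proves it, with no
  surface integrals and no value of the constant. The truncation is a function of 1 / |y - x|, so
  its gradient is a scalar multiple of the gradient of G. The L^r error thus reduces to the
  convergence of a bounded scalar factor against an integrable power of |z|.\<close>

primrec C_k_on :: "nat \<Rightarrow> 'a::real_normed_vector set \<Rightarrow> ('a \<Rightarrow> real) \<Rightarrow> bool" where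
  "C_k_on 0 S f \<longleftrightarrow> continuous_on S f"
| "C_k_on (Suc k) S f \<longleftrightarrow>
     (\<forall>x\<in>S. f differentiable (at x)) \<and> (\<forall>v. C_k_on k S (\<lambda>x. frechet_derivative f (at x) v))"

lemma C_k_on_UNIV: "C_k_on k UNIV f = C_k k f"
  by (induction k arbitrary: f) auto

lemma C_k_on_cong:
  assumes "open S" "\<And>x. x \<in> S \<Longrightarrow> f x = g x" "C_k_on k S f"
  shows "C_k_on k S g"
  using assms(2,3)
proof (induction k arbitrary: f g)
  case 0
  then show ?case using continuous_on_cong by (metis C_k_on.simps(1))
next
  case (Suc k)
  have "f differentiable (at x)" if "x \<in> S" for x
    using Suc.prems that by simp
  then have d: "(g has_derivative frechet_derivative f (at x)) (at x)" if "x \<in> S" for x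
    using that assms(1) Suc.prems(1) has_derivative_transform_within_open frechet_derivative_works
    by metis
  then have eq: "frechet_derivative f (at x) v = frechet_derivative g (at x) v" if "x \<in> S" for x v
    using that frechet_derivative_at by metis
  have "C_k_on k S (\<lambda>x. frechet_derivative g (at x) v)" for v
    by (rule Suc.IH[of "\<lambda>x. frechet_derivative f (at x) v"]) (use Suc.prems eq in auto)
  then show ?case using d by (auto intro: differentiableI)
qed

lemma C_k_on_SucI:
  assumes "open S" "\<And>x. x \<in> S \<Longrightarrow> (f has_derivative f' x) (at x)"
    and "\<And>v. C_k_on k S (\<lambda>x. f' x v)"
  shows "C_k_on (Suc k) S f"
proof -
  have eq: "f' x v = frechet_derivative f (at x) v" if "x \<in> S" for x v
    using that assms(2) frechet_derivative_at by metis
  have "C_k_on k S (\<lambda>x. frechet_derivative f (at x) v)" for v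
    by (rule C_k_on_cong[OF assms(1) eq assms(3)])
  then show ?thesis
    using assms(2) by (auto intro: differentiableI)
qed

lemma C_k_on_SucD:
  assumes "C_k_on (Suc k) S f" "x \<in> S"
  shows "(f has_derivative frechet_derivative f (at x)) (at x)"
  using assms frechet_derivative_works by auto

lemma C_k_on_Suc_imp: "C_k_on (Suc k) S f \<Longrightarrow> C_k_on k S f"
proof (induction k arbitrary: f)
  case 0
  then show ?case
    by (auto intro!: continuous_at_imp_continuous_on differentiable_imp_continuous_within)
next
  case (Suc k)
  then show ?case by (metis C_k_on.simps(2))
qed

text \<open>Gluing is why smoothness is localised to a set: \<open>bump\<close> is smooth off its
  centre as a composition, and near its centre because it vanishes there.\<close>

lemma C_k_on_Un:
  assumes "open S" "open T" "C_k_on k S f" "C_k_on k T f"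
  shows "C_k_on k (S \<union> T) f"
  using assms(3,4)
  by (induction k arbitrary: f) (auto intro: continuous_on_open_Un assms)

lemma C_k_on_const: "C_k_on k S (\<lambda>x. c)"
proof (induction k arbitrary: c)
  case (Suc k)
  then show ?case by simp
qed simp

lemma C_k_on_add:
  assumes "open S" "C_k_on k S f" "C_k_on k S g"
  shows "C_k_on k S (\<lambda>x. f x + g x)"
  using assms(2,3)
proof (induction k arbitrary: f g)
  case (Suc k)
  show ?case
    by (rule C_k_on_SucI[OF assms(1) has_derivative_add[OF C_k_on_SucD C_k_on_SucD]])
       (use Suc in auto)
qed (auto intro: continuous_on_add)

lemma C_k_on_mult:
  assumes "open S" "C_k_on k S f" "C_k_on k S g"
  shows "C_k_on k S (\<lambda>x. f x * g x)"
  using assms(2,3)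
proof (induction k arbitrary: f g)
  case (Suc k)
  show ?case
  proof (rule C_k_on_SucI[OF assms(1)])
    show "((\<lambda>x. f x * g x) has_derivative
        (\<lambda>v. f x * frechet_derivative g (at x) v + frechet_derivative f (at x) v * g x)) (at x)"
      if "x \<in> S" for x
      by (rule has_derivative_mult[OF C_k_on_SucD[OF Suc.prems(1) that] C_k_on_SucD[OF Suc.prems(2) that]])
    show "C_k_on k S (\<lambda>x. f x * frechet_derivative g (at x) v + frechet_derivative f (at x) v * g x)" for v
      using Suc.prems C_k_on_Suc_imp[OF Suc.prems(1)] C_k_on_Suc_imp[OF Suc.prems(2)]
      by (intro C_k_on_add assms(1) Suc.IH) simp_all
  qed
qed (auto intro: continuous_on_mult)

lemma C_k_on_prod:
  assumes "open S" "\<And>i. i \<in> I \<Longrightarrow> C_k_on k S (f i)"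
  shows "C_k_on k S (\<lambda>x. \<Prod>i\<in>I. f i x)"
  using assms(2)
  by (induction I rule: infinite_finite_induct) (auto intro: C_k_on_const C_k_on_mult assms(1))

lemma C_k_on_compose:
  fixes f :: "'a::real_normed_vector \<Rightarrow> real" and F :: "real \<Rightarrow> real"
  assumes "open S" "C_k_on k T F" "C_k_on k S f" "f ` S \<subseteq> T"
  shows "C_k_on k S (\<lambda>x. F (f x))"
  using assms(2-)
proof (induction k arbitrary: F)
  case 0
  then show ?case by (auto intro: continuous_on_compose2)
next
  case (Suc k)
  \<comment> \<open>A linear map on the reals is multiplication by its value at 1. This turns the
    chain rule into a product whose first factor is F' composed with \<open>f\<close>, to which the
    induction hypothesis applies.\<close>
  have lin: "frechet_derivative F (at (f x)) h = frechet_derivative F (at (f x)) 1 * h" if "x \<in> S" for x h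
  proof -
    have "linear (frechet_derivative F (at (f x)))"
      using Suc.prems that by (auto intro!: linear_frechet_derivative)
    from linear_scale[OF this, of h 1] show ?thesis by simp
  qed
  show ?case
  proof (rule C_k_on_SucI[OF assms(1)])
    show "((\<lambda>x. F (f x)) has_derivative
        (\<lambda>v. frechet_derivative F (at (f x)) 1 * frechet_derivative f (at x) v)) (at x)"
      if "x \<in> S" for x
    proof -
      have "(f has_derivative frechet_derivative f (at x)) (at x)"
        by (rule C_k_on_SucD[OF Suc.prems(2) that])
      moreover have "(F has_derivative frechet_derivative F (at (f x))) (at (f x))"
        by (rule C_k_on_SucD[OF Suc.prems(1)]) (use that Suc.prems(3) in auto)
      ultimately have "((\<lambda>x. F (f x)) has_derivative
          (\<lambda>v. frechet_derivative F (at (f x)) (frechet_derivative f (at x) v))) (at x)"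
        by (rule has_derivative_compose)
      then show ?thesis
        by (subst (asm) lin[OF that])
    qed
    show "C_k_on k S (\<lambda>x. frechet_derivative F (at (f x)) 1 * frechet_derivative f (at x) v)" for v
    proof (rule C_k_on_mult[OF assms(1)])
      show "C_k_on k S (\<lambda>x. frechet_derivative F (at (f x)) 1)"
        using Suc.prems by (intro Suc.IH[of "\<lambda>y. frechet_derivative F (at y) 1"] C_k_on_Suc_imp[OF Suc.prems(2)]) simp_all
      show "C_k_on k S (\<lambda>x. frechet_derivative f (at x) v)"
        using Suc.prems by simp
    qed
  qed
qed

lemma C_k_on_real_SucI:
  fixes f f' :: "real \<Rightarrow> real"
  assumes "open S" "\<And>x. x \<in> S \<Longrightarrow> (f has_real_derivative f' x) (at x)" "C_k_on k S f'"
  shows "C_k_on (Suc k) S f"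
proof (rule C_k_on_SucI[OF assms(1) assms(2)[unfolded has_field_derivative_def]])
  show "C_k_on k S (\<lambda>x. f' x * v)" for v
    by (intro C_k_on_mult assms(1,3) C_k_on_const)
qed

lemma C_k_on_inner_left: "open S \<Longrightarrow> C_k_on k S (\<lambda>x::'a::real_inner. x \<bullet> v)"
proof (cases k)
  case (Suc m)
  assume "open S"
  then show ?thesis unfolding Suc
    by (rule C_k_on_SucI) (auto intro!: derivative_eq_intros C_k_on_const)
qed (auto intro!: continuous_intros)

lemma C_k_on_ident: "open S \<Longrightarrow> C_k_on k S (\<lambda>x::real. x)"
  using C_k_on_inner_left[of S k "1::real"] by simp

lemma C_k_on_inner_self: "open S \<Longrightarrow> C_k_on k S (\<lambda>x::'a::real_inner. x \<bullet> x)"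
proof (cases k)
  case (Suc m)
  assume S: "open S"
  show ?thesis unfolding Suc
  proof (rule C_k_on_SucI[OF S])
    show "((\<lambda>x. x \<bullet> x) has_derivative (\<lambda>v. 2 * (x \<bullet> v))) (at x)" for x :: 'a
      by (auto intro!: derivative_eq_intros simp: inner_commute)
    show "C_k_on m S (\<lambda>x. 2 * (x \<bullet> v))" for v
      by (intro C_k_on_mult C_k_on_const C_k_on_inner_left S)
  qed
qed (auto intro!: continuous_intros)

lemma C_k_on_powr: "C_k_on k {0<..} (\<lambda>x::real. x powr a)"
proof (induction k arbitrary: a)
  case (Suc k)
  show ?case
    by (rule C_k_on_real_SucI[where f' = "\<lambda>x. a * x powr (a - 1)"])
       (auto intro!: Suc C_k_on_mult C_k_on_const has_real_derivative_powr)
qed (auto intro!: continuous_intros)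

lemma C_k_on_inverse_norm: "C_k_on k (- {0}) (\<lambda>x::'a::real_inner. 1 / norm x)"
proof -
  have "C_k_on k (- {0}) (\<lambda>x::'a. (x \<bullet> x) powr (- (1/2)))"
    by (rule C_k_on_compose[OF _ C_k_on_powr C_k_on_inner_self]) auto
  moreover have "(x \<bullet> x) powr (- (1/2)) = 1 / norm x" for x :: 'a
    using powr_minus_divide[of "x \<bullet> x" "1/2"] powr_half_sqrt[of "x \<bullet> x"]
    by (metis inner_ge_zero norm_eq_sqrt_inner)
  ultimately show ?thesis by simp
qed

section \<open>A flat function as the source of all cutoffs\<close>

definition flat_exp :: "real \<Rightarrow> real" where
  "flat_exp s = (if s > 0 then exp (- 1 / s) else 0)"

text \<open>The polynomial makes the class closed under differentiation: the derivative of P(1/s)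
  exp(-1/s) is Q(1/s) exp(-1/s) with Q(t) = t^2 (P(t) - P'(t)). Each member tends to 0 at 0 because
  exp(-t) beats every polynomial at infinity.\<close>

lemma C_k_on_poly_flat_exp:
  "C_k_on k UNIV (\<lambda>s. if s > 0 then poly P (1 / s) * exp (- 1 / s) else 0)"
proof -
  have lim: "((\<lambda>s. poly P (1 / s) * exp (- 1 / s)) \<longlongrightarrow> 0) (at_right 0)" for P :: "real poly"
  proof -
    have "((\<lambda>x. poly P x * exp (- x)) \<longlongrightarrow> 0) at_top"
    proof -
      have "((\<lambda>x. \<Sum>i\<le>degree P. coeff P i * (x ^ i / exp x)) \<longlongrightarrow> (\<Sum>i\<le>degree P. coeff P i * 0)) at_top"
        by (intro tendsto_sum tendsto_mult tendsto_const tendsto_power_div_exp_0)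
      then show ?thesis
        by (simp add: poly_altdef sum_distrib_right exp_minus divide_inverse mult.assoc)
    qed
    from filterlim_compose[OF this filterlim_inverse_at_top_right]
    show ?thesis by (simp add: divide_inverse)
  qed
  define E where "E P s = (if s > 0 then poly P (1 / s) * exp (- 1 / s) else 0)" for P and s :: real
  have lim0: "(E P \<longlongrightarrow> 0) (at 0)" for P
  proof (rule filterlim_split_at)
    show "(E P \<longlongrightarrow> 0) (at_left 0)"
      by (rule tendsto_eventually) (auto simp: E_def eventually_at_filter)
    show "(E P \<longlongrightarrow> 0) (at_right 0)"
      by (rule Lim_transform_eventually[OF lim[of P]]) (auto simp: E_def eventually_at_filter)
  qed
  define D where "D P = [:0,0,1:] * (P - pderiv P)" for P :: "real poly"
  have der: "(E P has_real_derivative E (D P) s) (at s)" for P s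
  proof -
    consider "s < 0" | "s = 0" | "s > 0" by linarith
    then show ?thesis
    proof cases
      case 1
      have "((\<lambda>_. 0) has_real_derivative E (D P) s) (at s)"
        using 1 by (simp add: E_def)
      then show ?thesis
        by (rule has_field_derivative_transform_within_open[where S="{..<0}"]) (use 1 in \<open>auto simp: E_def\<close>)
    next
      case 2
      \<comment> \<open>The difference quotient at 0 is again a member of the family, with the
        polynomial t P(t), so it tends to 0.\<close>
      have "((\<lambda>y. (E P y - E P 0) / (y - 0)) \<longlongrightarrow> 0) (at 0)"
        by (rule Lim_transform_eventually[OF lim0[of "pCons 0 P"]]) (auto simp: E_def eventually_at_filter)
      then show ?thesis
        using 2 by (simp add: has_field_derivative_iff E_def[of "D P"])
    next
      case 3
      have "((\<lambda>s. poly P (1 / s) * exp (- 1 / s)) has_real_derivative E (D P) s) (at s)"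
        using 3 by (auto simp: E_def D_def power2_eq_square field_simps intro!: derivative_eq_intros)
      then show ?thesis
        by (rule has_field_derivative_transform_within_open[where S="{0<..}"]) (use 3 in \<open>auto simp: E_def\<close>)
    qed
  qed
  have "C_k_on k UNIV (E P)"
  proof (induction k arbitrary: P)
    case 0
    show ?case
      using der by (auto intro!: continuous_at_imp_continuous_on DERIV_isCont)
  next
    case (Suc k)
    show ?case
      by (rule C_k_on_real_SucI[OF open_UNIV der Suc])
  qed
  then show ?thesis by (simp add: E_def[abs_def])
qed

lemma C_k_on_flat_exp: "C_k_on k UNIV flat_exp"
proof -
  have "flat_exp = (\<lambda>s. if s > 0 then poly 1 (1 / s) * exp (- 1 / s) else 0)"
    by (auto simp: flat_exp_def)
  then show ?thesis using C_k_on_poly_flat_exp[of k 1] by metis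
qed

lemma DERIV_flat_exp: "(flat_exp has_real_derivative flat_exp s / s\<^sup>2) (at s)"
proof -
  consider "s < 0" | "s = 0" | "s > 0" by linarith
  then show ?thesis
  proof cases
    case 1
    have "((\<lambda>_. 0) has_real_derivative flat_exp s / s\<^sup>2) (at s)"
      using 1 by (simp add: flat_exp_def)
    then show ?thesis
      by (rule has_field_derivative_transform_within_open[where S="{..<0}"])
         (use 1 in \<open>auto simp: flat_exp_def\<close>)
  next
    case 2
    have "flat_exp differentiable (at 0)"
      using C_k_on_flat_exp[of "Suc 0"] by simp
    then obtain l where l: "(flat_exp has_real_derivative l) (at 0)"
      using real_differentiable_def by blast
    \<comment> \<open>Smoothness provides a derivative at 0, and 0 is a minimum point. The claimed
      value \<open>flat_exp 0 / 0\<close> is 0 as well.\<close>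
    have "l = 0"
      by (rule DERIV_local_min[OF l, of 1]) (auto simp: flat_exp_def)
    then show ?thesis using l 2 by simp
  next
    case 3
    have "((\<lambda>s. exp (- 1 / s)) has_real_derivative flat_exp s / s\<^sup>2) (at s)"
      using 3 by (auto simp: flat_exp_def power2_eq_square field_simps intro!: derivative_eq_intros)
    then show ?thesis
      by (rule has_field_derivative_transform_within_open[where S="{0<..}"])
         (use 3 in \<open>auto simp: flat_exp_def\<close>)
  qed
qed

lemma flat_exp_bounds: "0 \<le> flat_exp s" "flat_exp s \<le> 1"
  by (auto simp: flat_exp_def)

lemma tendsto_flat_exp_scaled:
  assumes "s > 0" "filterlim t at_top F"
  shows "((\<lambda>n. flat_exp (t n * s)) \<longlongrightarrow> 1) F"
proof -
  have "filterlim (\<lambda>n. s * t n) at_top F"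
    by (rule filterlim_tendsto_pos_mult_at_top[OF tendsto_const assms])
  then have "((\<lambda>n. 1 / (s * t n)) \<longlongrightarrow> 0) F"
    using filterlim_at_infinity tendsto_divide_0[OF tendsto_const] filterlim_mono at_top_le_at_infinity order_refl by metis
  then have "((\<lambda>n. exp (- (1 / (s * t n)))) \<longlongrightarrow> exp (- 0)) F"
    by (intro tendsto_intros)
  then have "((\<lambda>n. exp (- (1 / (s * t n)))) \<longlongrightarrow> 1) F" by simp
  then show ?thesis
  proof (rule Lim_transform_eventually)
    show "\<forall>\<^sub>F n in F. exp (- (1 / (s * t n))) = flat_exp (t n * s)"
      using filterlim_at_top_dense[THEN iffD1, OF assms(2), rule_format, of 0]
      by eventually_elim (use assms(1) in \<open>auto simp: flat_exp_def mult.commute\<close>)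
  qed
qed

subsection \<open>Uniqueness of the weak gradient\<close>

lemma test_functionsD:
  assumes "\<phi> \<in> test_functions \<Omega>"
  shows "C_k_on k UNIV \<phi>" "compact (closure {x. \<phi> x \<noteq> 0})" "closure {x. \<phi> x \<noteq> 0} \<subseteq> \<Omega>"
  using assms by (auto simp: test_functions_def C_k_on_UNIV)

lemma test_functionsI:
  assumes "\<And>k. C_k_on k UNIV \<phi>" "compact K" "K \<subseteq> \<Omega>" "\<And>x. x \<notin> K \<Longrightarrow> \<phi> x = 0"
  shows "\<phi> \<in> test_functions \<Omega>"
proof -
  have "closure {x. \<phi> x \<noteq> 0} \<subseteq> K"
    using assms(2,4) by (intro closure_minimal compact_imp_closed) auto
  moreover from this have "compact (closure {x. \<phi> x \<noteq> 0})"
    using assms(2) compact_Int_closed[OF _ closed_closure] by (metis inf.absorb2)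
  ultimately show ?thesis
    using assms(1,3) by (auto simp: test_functions_def C_k_on_UNIV)
qed

text \<open>As \<open>t\<close> grows, these functions tend pointwise to the indicator of the open
  box and stay between 0 and 1. Dominated convergence then turns vanishing integrals against test
  functions into vanishing integrals over boxes.\<close>

definition box_bump :: "'a::euclidean_space \<Rightarrow> 'a \<Rightarrow> real \<Rightarrow> 'a \<Rightarrow> real" where
  "box_bump a b t x = (\<Prod>i\<in>Basis. flat_exp (t * (x \<bullet> i - a \<bullet> i)) * flat_exp (t * (b \<bullet> i - x \<bullet> i)))"

lemma C_k_on_box_bump: "C_k_on k UNIV (box_bump a b t)"
proof -
  have "C_k_on k UNIV (\<lambda>x. t * (x \<bullet> i - a \<bullet> i))" "C_k_on k UNIV (\<lambda>x. t * (b \<bullet> i - x \<bullet> i))" for i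
  proof -
    have "C_k_on k UNIV (\<lambda>x. t * (x \<bullet> i + - (a \<bullet> i)))"
      by (intro C_k_on_mult C_k_on_add C_k_on_const C_k_on_inner_left open_UNIV)
    then show "C_k_on k UNIV (\<lambda>x. t * (x \<bullet> i - a \<bullet> i))" by simp
    have "C_k_on k UNIV (\<lambda>x. t * (b \<bullet> i + - 1 * (x \<bullet> i)))"
      by (intro C_k_on_mult C_k_on_add C_k_on_const C_k_on_inner_left open_UNIV)
    then show "C_k_on k UNIV (\<lambda>x. t * (b \<bullet> i - x \<bullet> i))" by simp
  qed
  then show ?thesis
    unfolding box_bump_def[abs_def]
    by (intro C_k_on_prod open_UNIV C_k_on_mult[OF _ C_k_on_compose[OF _ C_k_on_flat_exp]
        C_k_on_compose[OF _ C_k_on_flat_exp]] subset_UNIV) simp_all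
qed

lemma box_bump_eq_0:
  assumes "x \<notin> box a b" "t \<ge> 0"
  shows "box_bump a b t x = 0"
proof -
  obtain i where i: "i \<in> Basis" "x \<bullet> i \<le> a \<bullet> i \<or> b \<bullet> i \<le> x \<bullet> i"
    using assms(1) by (force simp: mem_box)
  then have "flat_exp (t * (x \<bullet> i - a \<bullet> i)) * flat_exp (t * (b \<bullet> i - x \<bullet> i)) = 0"
    using assms(2) by (auto simp: flat_exp_def mult_less_0_iff zero_less_mult_iff)
  then show ?thesis
    unfolding box_bump_def using i(1) by (intro prod_zero) auto
qed

lemma box_bump_bounds: "0 \<le> box_bump a b t x" "box_bump a b t x \<le> 1"
  unfolding box_bump_def
  by (auto intro!: prod_nonneg prod_le_1 mult_le_one simp: flat_exp_bounds)

lemma tendsto_box_bump: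
  "(\<lambda>n. box_bump a b (real n) x) \<longlonglongrightarrow> indicator (box a b) x"
proof (cases "x \<in> box a b")
  case True
  have "(\<lambda>n. box_bump a b (real n) x) \<longlonglongrightarrow> (\<Prod>i\<in>(Basis::'a set). 1 * 1)"
    unfolding box_bump_def
    by (intro tendsto_prod tendsto_mult tendsto_flat_exp_scaled filterlim_real_sequentially)
       (use True in \<open>auto simp: mem_box\<close>)
  then show ?thesis using True by simp
qed (simp add: box_bump_eq_0)

lemma box_bump_test_function: "cbox a b \<subseteq> \<Omega> \<Longrightarrow> box_bump a b (real n) \<in> test_functions \<Omega>"
  by (rule test_functionsI[where K="cbox a b"])
     (use box_subset_cbox[of a b] in \<open>auto intro!: C_k_on_box_bump box_bump_eq_0\<close>)

section \<open>The fundamental lemma of the calculus of variations\<close>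

lemma sigma_finite_lebesgue: "sigma_finite_measure (lebesgue :: 'a::euclidean_space measure)"
proof
  obtain A :: "'a set set" where "countable A" "A \<subseteq> sets lborel" "\<Union>A = space lborel"
      "\<forall>a\<in>A. emeasure lborel a \<noteq> \<infinity>"
    using lborel.sigma_finite_countable by blast
  then show "\<exists>A::'a set set. countable A \<and> A \<subseteq> sets lebesgue \<and> \<Union>A = space lebesgue \<and>
      (\<forall>a\<in>A. emeasure lebesgue a \<noteq> \<infinity>)"
    by (intro exI[of _ A]) (auto simp: subset_eq)
qed

text \<open>Open boxes are stable under intersection and generate the Borel sets, so a Dynkin
  argument covers all Borel sets. A Lebesgue set differs from a Borel set by a null set, and an
  integrable function is determined almost everywhere by its integrals over measurable sets.\<close>

lemma AE_eq_0_if_box_integrals_eq_0: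
  fixes h :: "'a::euclidean_space \<Rightarrow> 'b::{banach, second_countable_topology}"
  assumes h: "integrable lebesgue h" and z: "\<And>a b. (LINT x:box a b|lebesgue. h x) = 0"
  shows "AE x in lebesgue. h x = 0"
proof -
  have int: "set_integrable lebesgue A h" if "A \<in> sets lebesgue" for A
    using h that by (auto simp: set_integrable_def intro: integrable_mult_indicator)
  \<comment> \<open>The complement step of the induction needs the integral over the whole space,
    obtained as a limit over growing boxes.\<close>
  have all: "(LINT x:UNIV|lebesgue. h x) = 0"
  proof -
    define e :: 'a where "e = \<Sum>Basis"
    have "(\<lambda>n. LINT x|lebesgue. indicator (box (- real n *\<^sub>R e) (real n *\<^sub>R e)) x *\<^sub>R h x)
        \<longlonglongrightarrow> (LINT x|lebesgue. h x)"
    proof (rule integral_dominated_convergence[where w="\<lambda>x. norm (h x)"])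
      show "AE x in lebesgue. (\<lambda>n. indicator (box (- real n *\<^sub>R e) (real n *\<^sub>R e)) x *\<^sub>R h x) \<longlonglongrightarrow> h x"
      proof (rule AE_I2, rule tendsto_eventually)
        fix x :: 'a
        obtain N where N: "norm x < real N" using reals_Archimedean2 by blast
        have "x \<in> box (- real n *\<^sub>R e) (real n *\<^sub>R e)" if "n \<ge> N" for n
        proof -
          have "\<bar>x \<bullet> i\<bar> < real n" if "i \<in> Basis" for i
            using Basis_le_norm[OF that, of x] N \<open>n \<ge> N\<close> by linarith
          then show ?thesis by (force simp: mem_box e_def inner_sum_left_Basis)
        qed
        then show "\<forall>\<^sub>F n in sequentially. indicator (box (- real n *\<^sub>R e) (real n *\<^sub>R e)) x *\<^sub>R h x = h x"
          by (intro eventually_sequentiallyI[of N]) simp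
      qed
      show "AE x in lebesgue. norm (indicator (box (- real n *\<^sub>R e) (real n *\<^sub>R e)) x *\<^sub>R h x) \<le> norm (h x)" for n
        by (rule AE_I2) (simp add: indicator_def)
    qed (use h in \<open>auto intro!: borel_measurable_scaleR borel_measurable_indicator\<close>)
    moreover have "(LINT x|lebesgue. indicator (box (- real n *\<^sub>R e) (real n *\<^sub>R e)) x *\<^sub>R h x) = 0" for n
      using z by (simp add: set_lebesgue_integral_def)
    ultimately have "(\<lambda>n. 0) \<longlonglongrightarrow> (LINT x|lebesgue. h x)"
      by simp
    from LIMSEQ_unique[OF this tendsto_const] show ?thesis by (simp add: set_lebesgue_integral_def)
  qed
  have borel: "(LINT x:A|lebesgue. h x) = 0" if "A \<in> sets borel" for A
  proof -
    have "Int_stable (range (\<lambda>(a, b). box a b :: 'a set))"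
      by (auto simp: Int_stable_def box_Int_box)
    moreover have "(range (\<lambda>(a, b). box a b :: 'a set)) \<subseteq> Pow UNIV" by simp
    moreover have "A \<in> sigma_sets UNIV (range (\<lambda>(a, b). box a b))"
      using that unfolding borel_eq_box by simp
    ultimately show ?thesis
    proof (induction rule: sigma_sets_induct_disjoint)
      case (basic A)
      then show ?case using z by auto
    next
      case empty
      then show ?case by (simp add: set_lebesgue_integral_def)
    next
      case (compl A)
      then have A: "A \<in> sets borel" by (simp add: borel_eq_box)
      have "(LINT x:(UNIV - A) \<union> A|lebesgue. h x) = (LINT x:(UNIV - A)|lebesgue. h x) + (LINT x:A|lebesgue. h x)"
        by (rule set_integral_Un) (use A in \<open>auto intro!: int\<close>)
      then show ?case using compl all by simp
    next
      case (union F)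
      then have F: "F i \<in> sets borel" for i by (auto simp: borel_eq_box)
      have "(LINT x:(\<Union>i. F i)|lebesgue. h x) = (\<Sum>i. (LINT x:F i|lebesgue. h x))"
        by (rule lebesgue_integral_countable_add)
           (use F union in \<open>auto intro!: int simp: disjoint_family_on_def\<close>)
      then show ?case using union by simp
    qed
  qed
  have "(LINT x:A|lebesgue. h x) = (LINT x:A|lebesgue. 0)" if A: "A \<in> sets lebesgue" for A
  proof -
    obtain S N N' where *: "A = S \<union> N" "N \<subseteq> N'" "N' \<in> null_sets lborel" "S \<in> sets lborel"
      using sets_completionE[OF A] by metis
    have "N' \<in> null_sets lebesgue"
      using *(3) by (rule null_sets_completionI)
    then have "(A - S) \<union> (S - A) \<in> null_sets lebesgue"
      using * completion.complete2[of "(A - S) \<union> (S - A)" N' lborel] by auto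
    then have "(LINT x:A|lebesgue. h x) = (LINT x:S|lebesgue. h x)"
      by (intro set_integral_null_delta h A) (use * in auto)
    then show ?thesis using borel *(4) by simp
  qed
  then show ?thesis
    by (intro sigma_finite_measure.density_unique_banach h sigma_finite_lebesgue) auto
qed

text \<open>\<open>h\<close> is only locally integrable, so the argument runs on one closed box
  inside \<Omega> at a time, where \<open>h\<close> cut off to the box is integrable on the whole
  space. Countably many such boxes cover \<Omega>.\<close>

lemma AE_eq_0_if_test_integrals_eq_0:
  fixes h :: "'a::euclidean_space \<Rightarrow> 'b::euclidean_space"
  assumes \<Omega>: "open \<Omega>" and h: "h \<in> L1_loc \<Omega>"
    and z: "\<And>\<phi>. \<phi> \<in> test_functions \<Omega> \<Longrightarrow> (LINT x|lebesgue_on \<Omega>. \<phi> x *\<^sub>R h x) = 0"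
  shows "AE x in lebesgue_on \<Omega>. h x = 0"
proof -
  have box0: "(LINT x:box a b|lebesgue. h x) = 0" if ab: "cbox a b \<subseteq> \<Omega>" for a b
  proof -
    have int: "set_integrable lebesgue (cbox a b) h"
      using h ab by (auto simp: L1_loc_def)
    have "(\<lambda>n. LINT x|lebesgue. box_bump a b (real n) x *\<^sub>R (indicator (cbox a b) x *\<^sub>R h x))
        \<longlonglongrightarrow> (LINT x|lebesgue. indicator (box a b) x *\<^sub>R (indicator (cbox a b) x *\<^sub>R h x))"
    proof (rule integral_dominated_convergence[where w="\<lambda>x. norm (indicator (cbox a b) x *\<^sub>R h x)"])
      have "continuous_on UNIV (box_bump a b (real n))" for n
        using C_k_on_box_bump[of 0 a b] by simp
      then have [measurable]: "box_bump a b (real n) \<in> borel_measurable lebesgue" for n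
        by (intro measurable_completion) (simp add: borel_measurable_continuous_onI)
      have *[measurable]: "(\<lambda>x. indicator (cbox a b) x *\<^sub>R h x) \<in> borel_measurable lebesgue"
        using int unfolding set_integrable_def by (rule borel_measurable_integrable)
      show "(\<lambda>x. box_bump a b (real n) x *\<^sub>R (indicator (cbox a b) x *\<^sub>R h x)) \<in> borel_measurable lebesgue" for n
        by measurable
      show "(\<lambda>x. indicator (box a b) x *\<^sub>R (indicator (cbox a b) x *\<^sub>R h x)) \<in> borel_measurable lebesgue"
        by (rule borel_measurable_scaleR[OF borel_measurable_indicator *]) simp
      show "integrable lebesgue (\<lambda>x. norm (indicator (cbox a b) x *\<^sub>R h x))"
        using int unfolding set_integrable_def by (rule integrable_norm)
      show "AE x in lebesgue. (\<lambda>n. box_bump a b (real n) x *\<^sub>R (indicator (cbox a b) x *\<^sub>R h x))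
          \<longlonglongrightarrow> indicator (box a b) x *\<^sub>R (indicator (cbox a b) x *\<^sub>R h x)"
        by (intro AE_I2 tendsto_scaleR tendsto_box_bump tendsto_const)
      show "AE x in lebesgue. norm (box_bump a b (real n) x *\<^sub>R (indicator (cbox a b) x *\<^sub>R h x))
          \<le> norm (indicator (cbox a b) x *\<^sub>R h x)" for n
        unfolding norm_scaleR[of "box_bump a b (real n) _"]
        by (intro AE_I2 mult_left_le_one_le) (auto simp: box_bump_bounds)
    qed
    moreover have "(LINT x|lebesgue. box_bump a b (real n) x *\<^sub>R (indicator (cbox a b) x *\<^sub>R h x)) = 0" for n
    proof -
      have eq: "box_bump a b (real n) x *\<^sub>R (indicator (cbox a b) x *\<^sub>R h x)
          = indicator \<Omega> x *\<^sub>R (box_bump a b (real n) x *\<^sub>R h x)" for x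
        using ab box_subset_cbox[of a b] box_bump_eq_0[of x a b "real n"]
        by (auto simp: indicator_def)
      show ?thesis
        unfolding eq using z[OF box_bump_test_function[OF ab, of n]] \<Omega>
        by (subst (asm) integral_restrict_space) auto
    qed
    moreover have "indicator (box a b) x *\<^sub>R (indicator (cbox a b) x *\<^sub>R h x) = indicator (box a b) x *\<^sub>R h x" for x
      using box_subset_cbox[of a b] by (auto simp: indicator_def)
    ultimately have "(\<lambda>n. 0) \<longlonglongrightarrow> (LINT x:box a b|lebesgue. h x)"
      unfolding set_lebesgue_integral_def by (simp only:)
    from LIMSEQ_unique[OF this tendsto_const] show ?thesis .
  qed
  have cbox0: "AE x in lebesgue. x \<in> cbox a b \<longrightarrow> h x = 0" if ab: "cbox a b \<subseteq> \<Omega>" for a b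
  proof -
    have int: "set_integrable lebesgue (cbox a b) h"
      using h ab by (auto simp: L1_loc_def)
    then have "set_integrable lebesgue (box a b) h"
      by (rule set_integrable_subset) (auto simp: box_subset_cbox)
    then have "AE x in lebesgue. indicator (box a b) x *\<^sub>R h x = 0"
      unfolding set_integrable_def
    proof (rule AE_eq_0_if_box_integrals_eq_0)
      fix c d
      obtain c' d' where cd: "box c d \<inter> box a b = box c' d'"
        using box_Int_box by blast
      have "(LINT x:box c' d'|lebesgue. h x) = 0"
      \<comment> \<open>A nonempty open box has \<open>cbox c' d'\<close> as its closure, which
        therefore lies in \<open>cbox a b\<close>. For an empty open box the closed box with the
        same corners need not lie in \<Omega>, so \<open>box0\<close> may not apply.\<close>
      proof (cases "box c' d' = {}")
        case False
        then have "cbox c' d' \<subseteq> cbox a b"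
          using cd closure_box[of c' d'] closure_mono[of "box c' d'" "cbox a b"] box_subset_cbox[of a b]
          by (metis closed_cbox closure_closed inf.coboundedI2)
        then show ?thesis using box0 ab by blast
      qed (simp add: set_lebesgue_integral_def)
      moreover have "indicator (box c d) x *\<^sub>R indicator (box a b) x *\<^sub>R h x = indicator (box c' d') x *\<^sub>R h x" for x
        unfolding cd[symmetric] by (auto simp: indicator_def)
      ultimately show "(LINT x:box c d|lebesgue. indicator (box a b) x *\<^sub>R h x) = 0"
        unfolding set_lebesgue_integral_def by (simp only:)
    qed
    moreover have "AE x in lebesgue. x \<notin> cbox a b - box a b"
      using negligible_frontier_interval negligible_iff_null_sets AE_not_in by blast
    ultimately show ?thesis
      by eventually_elim (auto simp: indicator_def)
  qed
  obtain \<D> where \<D>: "countable \<D>" "\<D> \<subseteq> Pow \<Omega>" "\<And>X. X \<in> \<D> \<Longrightarrow> \<exists>a b. X = cbox a b" "\<Union>\<D> = \<Omega>"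
    using open_countable_Union_open_cbox[OF \<Omega>] by metis
  have "\<forall>X\<in>\<D>. AE x in lebesgue. x \<in> X \<longrightarrow> h x = 0"
    using cbox0 \<D>(2,3) by blast
  then have "AE x in lebesgue. \<forall>X\<in>\<D>. x \<in> X \<longrightarrow> h x = 0"
    using \<D>(1) by (subst AE_ball_countable) auto
  then show ?thesis
    using \<D>(4) \<Omega> by (subst AE_restrict_space_iff) (auto elim!: eventually_mono)
qed

lemma integrable_bilinear_L1_loc:
  fixes h :: "'b::euclidean_space \<Rightarrow> 'c::euclidean_space \<Rightarrow> 'd::euclidean_space"
  assumes "bilinear h" and \<phi>: "continuous_on UNIV \<phi>" and K: "compact K" "K \<subseteq> \<Omega>"
    and z: "\<And>x. x \<notin> K \<Longrightarrow> \<phi> x = 0" and \<Omega>: "\<Omega> \<in> sets lebesgue" and g: "g \<in> L1_loc \<Omega>"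
  shows "integrable (lebesgue_on \<Omega>) (\<lambda>x. h (\<phi> x) (g x))"
proof -
  have c: "continuous_on K \<phi>" using \<phi> continuous_on_subset by blast
  have Ks: "K \<in> sets lebesgue" using K(1) lmeasurable_compact by blast
  have "(\<lambda>x. h (\<phi> x) (g x)) absolutely_integrable_on K"
  proof (rule absolutely_integrable_bounded_measurable_product[OF assms(1) _ Ks])
    show "\<phi> \<in> borel_measurable (lebesgue_on K)"
      by (rule continuous_imp_measurable_on_sets_lebesgue[OF c Ks])
    show "bounded (\<phi> ` K)"
      by (rule compact_imp_bounded[OF compact_continuous_image[OF c K(1)]])
    show "g absolutely_integrable_on K"
      using g K by (auto simp: L1_loc_def)
  qed
  then have "integrable lebesgue (\<lambda>x. indicator K x *\<^sub>R h (\<phi> x) (g x))"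
    by (simp add: set_integrable_def)
  moreover have "indicator K x *\<^sub>R h (\<phi> x) (g x) = indicator \<Omega> x *\<^sub>R h (\<phi> x) (g x)" for x
    using K(2) z[of x] bilinear_lzero[OF assms(1)] by (cases "x \<in> K") (auto simp: indicator_def)
  ultimately show ?thesis
    using \<Omega> by (subst integrable_restrict_space) auto
qed

lemma integrable_test_function_scaleR:
  fixes g :: "'a::euclidean_space \<Rightarrow> 'b::euclidean_space"
  assumes "\<phi> \<in> test_functions \<Omega>" "g \<in> L1_loc \<Omega>" "open \<Omega>"
  shows "integrable (lebesgue_on \<Omega>) (\<lambda>x. \<phi> x *\<^sub>R g x)"
proof (rule integrable_bilinear_L1_loc[where h="\<lambda>r v. r *\<^sub>R v"])
  show "bilinear (\<lambda>r (v::'b). r *\<^sub>R v)"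
    using bilinear_conv_bounded_bilinear bounded_bilinear_scaleR by blast
  show "\<phi> x = 0" if "x \<notin> closure {x. \<phi> x \<noteq> 0}" for x
    using that closure_subset[of "{x. \<phi> x \<noteq> 0}"] by blast
  show "continuous_on UNIV \<phi>" using test_functionsD(1)[OF assms(1), of 0] by simp
  show "\<Omega> \<in> sets lebesgue" using assms(3) by simp
qed (fact test_functionsD(2,3)[OF assms(1)] assms(2))+

text \<open>\<open>weak_grad\<close> is an arbitrary choice among weak gradients. Uniqueness carries
  integrability over to it from the witness provided by \<open>W1p\<close>.\<close>

lemma has_weak_gradient_unique:
  fixes \<Omega> :: "(real^'n) set"
  assumes \<Omega>: "open \<Omega>" and g: "has_weak_gradient \<Omega> u g" "has_weak_gradient \<Omega> u g'"
  shows "AE x in lebesgue_on \<Omega>. g x = g' x"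
proof -
  have L: "g \<in> L1_loc \<Omega>" "g' \<in> L1_loc \<Omega>"
    using g by (auto simp: has_weak_gradient_def)
  have "AE x in lebesgue_on \<Omega>. g x - g' x = 0"
  proof (rule AE_eq_0_if_test_integrals_eq_0[OF \<Omega>])
    show "(\<lambda>x. g x - g' x) \<in> L1_loc \<Omega>"
      using L by (auto simp: L1_loc_def set_integral_diff)
    fix \<phi> :: "real^'n \<Rightarrow> real" assume \<phi>: "\<phi> \<in> test_functions \<Omega>"
    have "(LINT x|lebesgue_on \<Omega>. \<phi> x *\<^sub>R g x) = (LINT x|lebesgue_on \<Omega>. \<phi> x *\<^sub>R g' x)"
    proof -
      have "- (LINT x|lebesgue_on \<Omega>. \<phi> x *\<^sub>R g x) = - (LINT x|lebesgue_on \<Omega>. \<phi> x *\<^sub>R g' x)"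
        using g[unfolded has_weak_gradient_def] \<phi> by (elim conjE, elim ballE[of _ _ \<phi>]) simp_all
      then show ?thesis by (rule neg_equal_iff_equal[THEN iffD1])
    qed
    moreover have "integrable (lebesgue_on \<Omega>) (\<lambda>x. \<phi> x *\<^sub>R g x)" "integrable (lebesgue_on \<Omega>) (\<lambda>x. \<phi> x *\<^sub>R g' x)"
      by (intro integrable_test_function_scaleR \<phi> \<Omega> L)+
    ultimately show "(LINT x|lebesgue_on \<Omega>. \<phi> x *\<^sub>R (g x - g' x)) = 0"
      unfolding scaleR_diff_right by (subst Bochner_Integration.integral_diff) simp_all
  qed
  then show ?thesis by simp
qed

subsection \<open>Lebesgue spaces\<close>

text \<open>Both claims come from Young's inequality for |f| / a and |g| / b: a = b = 1 gives
  integrability, and taking a and b to be the two norms gives the bound.\<close>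

lemma Lp_Hoelder:
  fixes f g :: "'a::euclidean_space \<Rightarrow> 'b::euclidean_space"
  assumes pq: "p > 1" "q > 1" "1 / p + 1 / q = 1" and f: "f \<in> Lp p \<Omega>" and g: "g \<in> Lp q \<Omega>"
  shows "integrable (lebesgue_on \<Omega>) (\<lambda>x. f x \<bullet> g x)"
    and "\<bar>LINT x|lebesgue_on \<Omega>. f x \<bullet> g x\<bar> \<le> Lp_norm p \<Omega> f * Lp_norm q \<Omega> g"
proof -
  define M where "M = lebesgue_on \<Omega>"
  have fm[measurable]: "f \<in> borel_measurable M" and fi: "integrable M (\<lambda>x. norm (f x) powr p)"
    using f by (auto simp: Lp_def M_def)
  have gm[measurable]: "g \<in> borel_measurable M" and gi: "integrable M (\<lambda>x. norm (g x) powr q)"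
    using g by (auto simp: Lp_def M_def)
  define A where "A = (LINT x|M. norm (f x) powr p)"
  define B where "B = (LINT x|M. norm (g x) powr q)"
  have AB: "A \<ge> 0" "B \<ge> 0" by (auto simp: A_def B_def)
  have young: "norm (f x \<bullet> g x) \<le> a * b * (norm (f x) powr p / (p * a powr p) + norm (g x) powr q / (q * b powr q))"
    if "a > 0" "b > 0" for a b x
  proof -
    have "norm (f x \<bullet> g x) \<le> norm (f x) * norm (g x)"
      by (simp add: Cauchy_Schwarz_ineq2)
    also have "\<dots> = a * b * ((norm (f x) / a) * (norm (g x) / b))"
      using that by simp
    also have "\<dots> \<le> a * b * ((norm (f x) / a) powr p / p + (norm (g x) / b) powr q / q)"
      using that by (intro mult_left_mono Youngs_inequality pq) auto
    finally show ?thesis using that by (simp add: powr_divide mult.commute)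
  qed
  show int: "integrable (lebesgue_on \<Omega>) (\<lambda>x. f x \<bullet> g x)"
    unfolding M_def[symmetric]
  proof (rule Bochner_Integration.integrable_bound)
    show "integrable M (\<lambda>x. norm (f x) powr p / p + norm (g x) powr q / q)"
      using fi gi by auto
    show "AE x in M. norm (f x \<bullet> g x) \<le> norm (norm (f x) powr p / p + norm (g x) powr q / q)"
      using order_trans[OF young[of 1 1] abs_ge_self] by (intro AE_I2) simp
  qed measurable
  show "\<bar>LINT x|lebesgue_on \<Omega>. f x \<bullet> g x\<bar> \<le> Lp_norm p \<Omega> f * Lp_norm q \<Omega> g"
  \<comment> \<open>The normalisation divides by both norms. If one of them is 0, the integrand
    vanishes almost everywhere.\<close>
  proof (cases "A = 0 \<or> B = 0")
    case True
    have "AE x in M. f x \<bullet> g x = 0"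
    proof -
      have "AE x in M. norm (f x) powr p = 0" if "A = 0"
        using that fi by (subst (asm) A_def, subst (asm) integral_nonneg_eq_0_iff_AE) auto
      moreover have "AE x in M. norm (g x) powr q = 0" if "B = 0"
        using that gi by (subst (asm) B_def, subst (asm) integral_nonneg_eq_0_iff_AE) auto
      ultimately show ?thesis using True by (auto elim!: eventually_mono)
    qed
    then have "(LINT x|M. f x \<bullet> g x) = 0" by (rule integral_eq_zero_AE)
    then show ?thesis by (simp add: M_def Lp_norm_def)
  next
    case False
    then have AB: "A > 0" "B > 0" using AB by auto
    define a where "a = A powr (1 / p)"
    define b where "b = B powr (1 / q)"
    have ab: "a > 0" "b > 0" "a powr p = A" "b powr q = B"
      using AB pq by (auto simp: a_def b_def powr_powr)
    have "\<bar>LINT x|M. f x \<bullet> g x\<bar> \<le> (LINT x|M. norm (f x \<bullet> g x))"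
      using integral_norm_bound[of M "\<lambda>x. f x \<bullet> g x"] by simp
    also have "\<dots> \<le> (LINT x|M. a * b * (norm (f x) powr p / (p * A) + norm (g x) powr q / (q * B)))"
      using int fi gi young[OF ab(1,2)] ab(3,4)
      by (intro integral_mono) (auto simp: M_def)
    also have "\<dots> = a * b * (A / (p * A) + B / (q * B))"
      using fi gi by (simp add: A_def B_def)
    also have "\<dots> = a * b" using AB pq by simp
    finally show ?thesis by (simp add: M_def Lp_norm_def a_def b_def A_def B_def)
  qed
qed

lemma Lp_diff:
  assumes "p > 0" and f: "f \<in> Lp p \<Omega>" and g: "g \<in> Lp p \<Omega>"
  shows "(\<lambda>x. f x - g x) \<in> Lp p \<Omega>"
proof -
  have fm[measurable]: "f \<in> borel_measurable (lebesgue_on \<Omega>)" "g \<in> borel_measurable (lebesgue_on \<Omega>)"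
    using f g by (auto simp: Lp_def)
  have "integrable (lebesgue_on \<Omega>) (\<lambda>x. norm (f x - g x) powr p)"
  proof (rule Bochner_Integration.integrable_bound)
    show "integrable (lebesgue_on \<Omega>) (\<lambda>x. 2 powr p * (norm (f x) powr p + norm (g x) powr p))"
      using f g by (auto simp: Lp_def)
    have "norm (f x - g x) powr p \<le> 2 powr p * (norm (f x) powr p + norm (g x) powr p)" for x
    proof -
      have "norm (f x - g x) powr p \<le> (2 * max (norm (f x)) (norm (g x))) powr p"
        using norm_triangle_ineq4[of "f x" "g x"] assms(1) by (intro powr_mono2) auto
      also have "\<dots> = 2 powr p * max (norm (f x)) (norm (g x)) powr p"
        by (rule powr_mult)
      also have "\<dots> \<le> 2 powr p * (norm (f x) powr p + norm (g x) powr p)"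
        by (intro mult_left_mono) (auto simp: max_def)
      finally show ?thesis .
    qed
    then show "AE x in lebesgue_on \<Omega>. norm (norm (f x - g x) powr p)
        \<le> norm (2 powr p * (norm (f x) powr p + norm (g x) powr p))"
      by (intro AE_I2) simp
  qed measurable
  then show ?thesis by (simp add: Lp_def)
qed

lemma Lp_cong_AE:
  assumes \<Omega>: "\<Omega> \<in> sets lebesgue" and f: "f \<in> Lp p \<Omega>" and eq: "AE x in lebesgue_on \<Omega>. f x = g x"
  shows "g \<in> Lp p \<Omega>"
proof -
  \<comment> \<open>Measurability of \<open>g\<close> rests on completeness of Lebesgue measure on
    the whole space, hence the extension by zero.\<close>
  have eq': "AE x in lebesgue. (if x \<in> \<Omega> then f x else 0) = (if x \<in> \<Omega> then g x else 0)"
    using eq \<Omega> by (subst (asm) AE_restrict_space_iff) (auto elim: eventually_mono)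
  have "f \<in> borel_measurable (lebesgue_on \<Omega>)" using f by (simp add: Lp_def)
  then have "(\<lambda>x. if x \<in> \<Omega> then f x else 0) \<in> borel_measurable lebesgue"
    using \<Omega> borel_measurable_if by blast
  then have "(\<lambda>x. if x \<in> \<Omega> then g x else 0) \<in> borel_measurable lebesgue"
    using eq' by (rule borel_measurable_AE)
  then have gm[measurable]: "g \<in> borel_measurable (lebesgue_on \<Omega>)"
    using \<Omega> borel_measurable_if by blast
  have fm[measurable]: "f \<in> borel_measurable (lebesgue_on \<Omega>)" using f by (simp add: Lp_def)
  have "integrable (lebesgue_on \<Omega>) (\<lambda>x. norm (g x) powr p)"
  proof (rule integrable_cong_AE_imp)
    show "integrable (lebesgue_on \<Omega>) (\<lambda>x. norm (f x) powr p)" using f by (simp add: Lp_def)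
    show "AE x in lebesgue_on \<Omega>. norm (f x) powr p = norm (g x) powr p"
      using eq by (auto elim: eventually_mono)
  qed measurable
  then show ?thesis using gm by (simp add: Lp_def)
qed

lemma bounded_in_Lp:
  assumes "\<Omega> \<in> lmeasurable" "p > 0" "f \<in> borel_measurable (lebesgue_on \<Omega>)" "\<And>x. norm (f x) \<le> B"
  shows "f \<in> Lp p \<Omega>"
proof -
  interpret finite_measure "lebesgue_on \<Omega>"
    using assms(1) by (rule finite_measure_lebesgue_on)
  have "integrable (lebesgue_on \<Omega>) (\<lambda>x. norm (f x) powr p)"
    using assms by (intro integrable_const_bound[where B="B powr p"] AE_I2) (auto intro!: powr_mono2)
  then show ?thesis using assms(3) by (simp add: Lp_def)
qed

lemma weak_grad_in_Lp:
  assumes "open \<Omega>" "u \<in> W1p p \<Omega>"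
  shows "weak_grad \<Omega> u \<in> Lp p \<Omega>"
proof -
  obtain g where g: "g \<in> Lp p \<Omega>" "has_weak_gradient \<Omega> u g"
    using assms(2) by (auto simp: W1p_def)
  then have "has_weak_gradient \<Omega> u (weak_grad \<Omega> u)"
    unfolding weak_grad_def by (metis someI)
  then have "AE x in lebesgue_on \<Omega>. g x = weak_grad \<Omega> u x"
    using has_weak_gradient_unique[OF assms(1) g(2)] by blast
  then show ?thesis
    using Lp_cong_AE[OF _ g(1)] assms(1) by simp
qed

subsection \<open>Gradients of test functions\<close>

lemma C_k_has_derivative_grad:
  fixes \<phi> :: "real^'n \<Rightarrow> real"
  assumes "C_k_on (Suc k) UNIV \<phi>"
  shows "(\<phi> has_derivative (\<lambda>v. grad \<phi> x \<bullet> v)) (at x)"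
proof -
  have d: "(\<phi> has_derivative frechet_derivative \<phi> (at x)) (at x)"
    using C_k_on_SucD[OF assms] by simp
  have "frechet_derivative \<phi> (at x) v = grad \<phi> x \<bullet> v" for v
  proof -
    have lin: "linear (frechet_derivative \<phi> (at x))"
      using d has_derivative_linear by blast
    have "frechet_derivative \<phi> (at x) v = frechet_derivative \<phi> (at x) (\<Sum>i\<in>UNIV. (v $ i) *\<^sub>R axis i 1)"
      using basis_expansion[of v] by (simp add: scalar_mult_eq_scaleR)
    also have "\<dots> = (\<Sum>i\<in>UNIV. (v $ i) * frechet_derivative \<phi> (at x) (axis i 1))"
      by (simp add: linear_sum[OF lin] linear_scale[OF lin])
    finally show ?thesis by (simp add: inner_vec_def grad_def mult.commute)
  qed
  then show ?thesis using d by (metis (no_types, lifting) ext)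
qed

lemma grad_eqI:
  assumes "(\<phi> has_derivative (\<lambda>v. w \<bullet> v)) (at x)"
  shows "grad \<phi> x = w"
  unfolding grad_def frechet_derivative_at[OF assms, symmetric]
  by (simp add: vec_eq_iff inner_axis)

lemma continuous_grad:
  fixes \<phi> :: "real^'n \<Rightarrow> real"
  assumes "C_k_on (Suc 0) UNIV \<phi>"
  shows "continuous_on UNIV (grad \<phi>)"
  unfolding grad_def[abs_def] using assms by (intro continuous_on_vec_lambda) simp

lemma grad_eq_0_outside:
  assumes "closed K" "\<And>x. x \<notin> K \<Longrightarrow> \<phi> x = 0" "x \<notin> K"
  shows "grad \<phi> x = 0"
proof (rule grad_eqI)
  have "((\<lambda>_. 0) has_derivative (\<lambda>v. 0 \<bullet> v)) (at x)" by simp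
  then show "(\<phi> has_derivative (\<lambda>v. 0 \<bullet> v)) (at x)"
    by (rule has_derivative_transform_within_open[where s="- K"]) (use assms in auto)
qed

lemma test_function_grad:
  assumes \<phi>: "\<phi> \<in> test_functions \<Omega>"
  obtains K B where "compact K" "K \<subseteq> \<Omega>" "\<And>x. x \<notin> K \<Longrightarrow> \<phi> x = 0" "\<And>x. x \<notin> K \<Longrightarrow> grad \<phi> x = 0"
    "\<And>x. norm (grad \<phi> x) \<le> B" "B > 0"
proof -
  define K where "K = closure {x. \<phi> x \<noteq> 0}"
  have K: "compact K" "K \<subseteq> \<Omega>" using test_functionsD[OF \<phi>] by (auto simp: K_def)
  have z: "\<phi> x = 0" if "x \<notin> K" for x
    using that closure_subset[of "{x. \<phi> x \<noteq> 0}"] unfolding K_def by blast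
  have gz: "grad \<phi> x = 0" if "x \<notin> K" for x
    by (rule grad_eq_0_outside[OF compact_imp_closed[OF K(1)] z that])
  have "continuous_on K (grad \<phi>)"
    using continuous_grad test_functionsD(1)[OF \<phi>] continuous_on_subset by blast
  then obtain B where B: "B > 0" "\<And>x. x \<in> K \<Longrightarrow> norm (grad \<phi> x) \<le> B"
    using compact_imp_bounded[OF compact_continuous_image[OF _ K(1)]] bounded_pos[of "grad \<phi> ` K"] by auto
  have "norm (grad \<phi> x) \<le> B" for x
    using B gz[of x] by (cases "x \<in> K") auto
  then show ?thesis using that K z gz B(1) by blast
qed

lemma borel_measurable_grad:
  assumes "\<phi> \<in> test_functions \<Omega>"
  shows "grad \<phi> \<in> borel_measurable (lebesgue_on S)"
proof -
  have "grad \<phi> \<in> borel_measurable borel"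
    using continuous_grad test_functionsD(1)[OF assms] borel_measurable_continuous_onI by blast
  then have "grad \<phi> \<in> borel_measurable lebesgue"
    by (intro measurable_completion) simp
  then show ?thesis by (rule measurable_restrict_space1)
qed

lemma grad_in_Lp:
  assumes "\<phi> \<in> test_functions \<Omega>" "S \<in> lmeasurable" "p > 0"
  shows "grad \<phi> \<in> Lp p S"
proof -
  obtain B where "\<And>x. norm (grad \<phi> x) \<le> B" using test_function_grad[OF assms(1)] by metis
  then show ?thesis using bounded_in_Lp borel_measurable_grad assms by blast
qed

subsection \<open>The singular kernel\<close>

text \<open>Dyadic decomposition: the function is dominated by a series of multiples of indicators
  of the balls of radius R / 2^k. The integrals of its terms form a geometric series of ratio 2^a /
  2^n, where n is the dimension, and a < n makes it converge.\<close>

lemma integrable_norm_powr_ball: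
  fixes a R :: real
  assumes a: "0 \<le> a" "a < DIM('a::euclidean_space)" and R: "R > 0"
  shows "integrable lborel (\<lambda>x::'a. indicator (ball 0 R) x * norm x powr (- a))"
proof (rule integrableI_bounded)
  have [measurable]: "ball (0::'a) r \<in> sets borel" for r by simp
  show "(\<lambda>x::'a. indicator (ball 0 R) x * norm x powr (- a)) \<in> borel_measurable lborel"
    by measurable
  \<comment> \<open>\<open>c k\<close> is the value of |x|^(-a) at the inner radius R / 2^(k+1) of
    the k-th shell, and so an upper bound on that shell.\<close>
  define c where "c k = R powr (- a) * (2 powr a) ^ Suc k" for k
  define V where "V = unit_ball_vol (real DIM('a))"
  define r where "r = 2 powr a / 2 ^ DIM('a)"
  have c0: "c k \<ge> 0" for k by (simp add: c_def)
  have le: "ennreal (norm (indicator (ball 0 R) x * norm x powr (- a)))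
      \<le> (\<Sum>k. ennreal (c k) * indicator (ball 0 (R / 2 ^ k)) x)" for x :: 'a
  \<comment> \<open>At the origin the integrand is 0, since \<open>0 powr (- a) = 0\<close>; outside
    the ball it is 0 by the indicator.\<close>
  proof (cases "x \<noteq> 0 \<and> norm x < R")
    case True
    define F :: "nat \<Rightarrow> ennreal" where "F k = ennreal (c k) * indicator (ball 0 (R / 2 ^ k)) x" for k
    \<comment> \<open>The first dyadic radius not exceeding |x|. It is not the 0-th one because |x|
      < R, so x lies in the shell with index N - 1.\<close>
    define N where "N = (LEAST n. R / 2 ^ n \<le> norm x)"
    obtain n where "R / norm x < 2 ^ n"
      using real_arch_pow[of 2 "R / norm x"] by auto
    then have "R / 2 ^ n \<le> norm x" using True by (simp add: field_simps)
    then have N: "R / 2 ^ N \<le> norm x" unfolding N_def by (rule LeastI)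
    then have "N \<noteq> 0" using True by (intro notI) simp
    then obtain k where k: "N = Suc k" by (cases N) auto
    then have kx: "norm x < R / 2 ^ k"
      using not_less_Least[of k "\<lambda>n. R / 2 ^ n \<le> norm x"] by (simp add: N_def)
    have "norm x powr (- a) \<le> (R / 2 ^ Suc k) powr (- a)"
      using N R a True unfolding k by (intro powr_mono2') auto
    also have "\<dots> = R powr (- a) / (2 ^ Suc k) powr (- a)"
      using R by (simp add: powr_divide)
    also have "(2 ^ Suc k) powr (- a) = inverse ((2 powr a) ^ Suc k)"
      by (simp add: powr_minus powr_powr mult.commute flip: powr_realpow del: power_Suc)
    also have "R powr (- a) / inverse ((2 powr a) ^ Suc k) = c k"
      by (simp add: c_def divide_inverse)
    finally have "ennreal (norm (indicator (ball 0 R) x * norm x powr (- a)))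
        \<le> ennreal (c k) * indicator (ball 0 (R / 2 ^ k)) x"
      using True kx c0 by (auto simp: indicator_def intro!: ennreal_leI)
    also have "\<dots> = F k" by (simp only: F_def)
    also have "\<dots> = sum F {k}" by simp
    also have "\<dots> \<le> suminf F"
      by (rule sum_le_suminf[OF summableI]) auto
    also have "\<dots> = (\<Sum>k. ennreal (c k) * indicator (ball 0 (R / 2 ^ k)) x)"
      by (simp add: F_def[abs_def])
    finally show ?thesis .
  qed auto
  have "(\<integral>\<^sup>+x. ennreal (norm (indicator (ball 0 R) x * norm x powr (- a))) \<partial>(lborel::'a measure))
      \<le> (\<integral>\<^sup>+x. (\<Sum>k. ennreal (c k) * indicator (ball 0 (R / 2 ^ k)) x) \<partial>(lborel::'a measure))"
    by (intro nn_integral_mono le)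
  also have "\<dots> = (\<Sum>k. \<integral>\<^sup>+x. ennreal (c k) * indicator (ball 0 (R / 2 ^ k)) x \<partial>(lborel::'a measure))"
    by (rule nn_integral_suminf) measurable
  also have "\<dots> = (\<Sum>k. ennreal ((R powr (- a) * 2 powr a * V * R ^ DIM('a)) * r ^ k))"
  proof (intro suminf_cong)
    fix k
    have "(\<integral>\<^sup>+x. ennreal (c k) * indicator (ball 0 (R / 2 ^ k)) x \<partial>(lborel::'a measure))
        = ennreal (c k) * emeasure lborel (ball (0::'a) (R / 2 ^ k))"
      by (rule nn_integral_cmult_indicator) simp
    also have "\<dots> = ennreal (c k) * ennreal (V * (R / 2 ^ k) ^ DIM('a))"
      using R by (subst emeasure_ball) (auto simp: V_def)
    also have "\<dots> = ennreal (c k * (V * (R / 2 ^ k) ^ DIM('a)))"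
      using c0 by (rule ennreal_mult'[symmetric])
    also have "c k * (V * (R / 2 ^ k) ^ DIM('a)) = (R powr (- a) * 2 powr a * V * R ^ DIM('a)) * r ^ k"
      by (simp add: c_def r_def power_divide power_mult[symmetric] mult_ac)
    finally show "(\<integral>\<^sup>+x. ennreal (c k) * indicator (ball 0 (R / 2 ^ k)) x \<partial>(lborel::'a measure))
        = ennreal ((R powr (- a) * 2 powr a * V * R ^ DIM('a)) * r ^ k)" .
  qed
  also have "\<dots> < \<infinity>"
  proof -
    have "2 powr a < 2 powr real DIM('a)" using a by (intro powr_less_mono) auto
    then have r: "0 \<le> r" "r < 1" by (auto simp: r_def powr_realpow)
    have "summable (\<lambda>k. (R powr (- a) * 2 powr a * V * R ^ DIM('a)) * r ^ k)"
      using r by (intro summable_mult summable_geometric) auto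
    then show ?thesis
      using r R by (subst suminf_ennreal2) (auto simp: V_def intro!: mult_nonneg_nonneg)
  qed
  finally show "(\<integral>\<^sup>+x. ennreal (norm (indicator (ball 0 R) x * norm x powr (- a))) \<partial>(lborel::'a measure)) < \<infinity>" .
qed

lemma lborel_integral_scaleR:
  fixes f :: "'a::euclidean_space \<Rightarrow> real"
  assumes "c > 0" and [measurable]: "f \<in> borel_measurable borel"
  shows "(LINT x|lborel. f x) = c ^ DIM('a) * (LINT x|lborel. f (c *\<^sub>R x))"
proof -
  have "(LINT x|lborel. f x)
      = (LINT x|density (distr lborel borel (\<lambda>x. 0 + c *\<^sub>R x)) (\<lambda>_. \<bar>c\<bar> ^ DIM('a)). f x)"
    using assms(1) by (subst lborel_affine[of c 0]) simp_all
  also have "\<dots> = (LINT x|distr lborel borel (\<lambda>x. 0 + c *\<^sub>R x). \<bar>c\<bar> ^ DIM('a) * f x)"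
    by (subst integral_density) auto
  also have "\<dots> = (LINT x|lborel. c ^ DIM('a) * f (c *\<^sub>R x))"
    using assms(1) by (subst integral_distr) auto
  finally show ?thesis by simp
qed

text \<open>The integral of \<open>\<psi>(c z) / |z|\<^sup>n\<close> does not depend on \<open>c > 0\<close>, and the integrand below is its
  derivative at \<open>c = 1\<close>.\<close>

lemma integral_grad_kernel_eq_0:
  fixes \<psi> :: "'a::euclidean_space \<Rightarrow> real" and g :: "'a \<Rightarrow> 'a"
  assumes der: "\<And>z. (\<psi> has_derivative (\<lambda>v. g z \<bullet> v)) (at z)"
    and B: "\<And>z. norm (g z) \<le> B" and R: "\<And>z. norm z \<ge> R \<Longrightarrow> \<psi> z = 0" "R > 0" and "\<psi> 0 = 0"
    and [measurable]: "g \<in> borel_measurable borel"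
  shows "(LINT z|lborel. g z \<bullet> z / norm z ^ DIM('a)) = 0"
proof -
  let ?n = "DIM('a)"
  have B0: "B \<ge> 0" using B norm_ge_zero order_trans by blast
  have lip: "\<bar>\<psi> x - \<psi> y\<bar> \<le> B * norm (x - y)" for x y
  proof -
    have "norm (\<psi> x - \<psi> y) \<le> B * norm (x - y)"
    proof (rule differentiable_bound[of UNIV])
      show "onorm (\<lambda>v. g z \<bullet> v) \<le> B" for z
        by (rule onorm_le) (metis B Cauchy_Schwarz_ineq2 mult_right_mono norm_ge_zero order_trans real_norm_def)
    qed (use der in auto)
    then show ?thesis by simp
  qed
  have "continuous_on UNIV \<psi>"
    using der by (auto intro!: continuous_at_imp_continuous_on has_derivative_continuous)
  then have [measurable]: "\<psi> \<in> borel_measurable borel" by (rule borel_measurable_continuous_onI)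
  \<comment> \<open>\<open>\<psi>\<close> is Lipschitz with constant \<open>B\<close> and vanishes
    at 0, so |\<psi>(z)| \<le> B |z|. Dividing by |z|^n leaves B |z|^(1-n), which is integrable at
    the origin.\<close>
  define w where "w z = B * (indicator (ball 0 R) z * norm z powr (- (real ?n - 1)))" for z :: 'a
  have wi: "integrable lborel w"
    unfolding w_def[abs_def] using R(2) by (intro integrable_mult_right integrable_norm_powr_ball) (auto simp: Suc_leI)
  have weq: "w z = B * norm z / norm z ^ ?n" if "norm z < R" for z
  proof (cases "z = 0")
    case False
    have "norm z powr (- (real ?n - 1)) = norm z powr (1 - real ?n)" by simp
    also have "\<dots> = norm z / norm z ^ ?n"
      using False by (simp add: powr_diff powr_realpow)
    finally show ?thesis using that by (simp add: w_def)
  qed (simp add: w_def)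
  have w0: "w z \<ge> 0" for z using B0 by (auto simp: w_def)
  \<comment> \<open>The difference quotients of t -> \<psi>(t z) / |z|^n at t = 1, with step 1 / (m
    + 1). Their integrals vanish by dilation invariance, and their pointwise limit is the integrand
    of the claim.\<close>
  define D where "D m z = (\<psi> ((1 + 1 / real (Suc m)) *\<^sub>R z) - \<psi> z) * real (Suc m) / norm z ^ ?n" for m z
  have D: "(LINT z|lborel. D m z) = 0" for m
  proof -
    define c where "c = 1 + 1 / real (Suc m)"
    \<comment> \<open>Dilating by a factor of at least 1 keeps the support inside the ball of radius
      \<open>R\<close>, so one majorant \<open>w\<close> serves all \<open>m\<close>.\<close>
    have c: "c > 0" "c \<ge> 1" by (auto simp: c_def add_pos_nonneg)
    have bound: "\<bar>\<psi> (b *\<^sub>R z) / norm z ^ ?n\<bar> \<le> b * w z" if "b \<ge> 1" for b z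
    proof (cases "norm z < R")
      case True
      have "\<bar>\<psi> (b *\<^sub>R z)\<bar> \<le> B * (b * norm z)"
        using lip[of "b *\<^sub>R z" 0] assms(5) that by simp
      then have "\<bar>\<psi> (b *\<^sub>R z) / norm z ^ ?n\<bar> \<le> B * (b * norm z) / norm z ^ ?n"
        by (simp add: divide_right_mono)
      then show ?thesis using weq[OF True] by (simp add: mult_ac)
    next
      case False
      then have "norm (b *\<^sub>R z) \<ge> R" using that mult_right_mono[of 1 b "norm z"] by auto
      then have "\<psi> (b *\<^sub>R z) = 0" by (rule R)
      then show ?thesis using w0 that by simp
    qed
    have int: "integrable lborel (\<lambda>z. \<psi> (b *\<^sub>R z) / norm z ^ ?n)" if "b \<ge> 1" for b
    proof (rule Bochner_Integration.integrable_bound)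
      show "integrable lborel (\<lambda>z. b * w z)" using wi by simp
      show "AE z in lborel. norm (\<psi> (b *\<^sub>R z) / norm z ^ ?n) \<le> norm (b * w z)"
        using order_trans[OF bound[OF that] abs_ge_self] by (intro AE_I2) simp
    qed measurable
    \<comment> \<open>The Jacobian c^n of the dilation cancels against the c^n contained in |c
      z|^n.\<close>
    have "(LINT z|lborel. \<psi> z / norm z ^ ?n) = c ^ ?n * (LINT z|lborel. \<psi> (c *\<^sub>R z) / norm (c *\<^sub>R z) ^ ?n)"
      by (rule lborel_integral_scaleR[OF c(1)]) measurable
    also have "\<dots> = (LINT z|lborel. \<psi> (c *\<^sub>R z) / norm z ^ ?n)"
      using c by (simp add: power_mult_distrib flip: integral_mult_right_zero)
    finally have eq: "(LINT z|lborel. \<psi> z / norm z ^ ?n) = (LINT z|lborel. \<psi> (c *\<^sub>R z) / norm z ^ ?n)" .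
    have "D m z = real (Suc m) * (\<psi> (c *\<^sub>R z) / norm z ^ ?n - \<psi> z / norm z ^ ?n)" for z
      by (simp add: D_def c_def diff_divide_distrib algebra_simps)
    then have "(LINT z|lborel. D m z)
        = real (Suc m) * (LINT z|lborel. \<psi> (c *\<^sub>R z) / norm z ^ ?n - \<psi> z / norm z ^ ?n)"
      by (simp only: integral_mult_right_zero)
    also have "\<dots> = 0"
      using int[OF c(2)] int[of 1] eq by (subst Bochner_Integration.integral_diff) auto
    finally show ?thesis .
  qed
  have "(\<lambda>m. LINT z|lborel. D m z) \<longlonglongrightarrow> (LINT z|lborel. g z \<bullet> z / norm z ^ ?n)"
  proof (rule integral_dominated_convergence[where w=w])
    show "AE z in lborel. (\<lambda>m. D m z) \<longlonglongrightarrow> g z \<bullet> z / norm z ^ ?n"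
    proof (rule AE_I2)
      fix z :: 'a
      have "((\<lambda>t. \<psi> (t *\<^sub>R z)) has_derivative (\<lambda>t. g (1 *\<^sub>R z) \<bullet> (t *\<^sub>R z))) (at 1)"
        by (rule has_derivative_compose[OF _ der]) (auto intro!: derivative_eq_intros)
      then have "((\<lambda>t. \<psi> (t *\<^sub>R z)) has_real_derivative g z \<bullet> z) (at 1)"
        unfolding has_field_derivative_def by (rule has_derivative_eq_rhs) auto
      then have "((\<lambda>h. (\<psi> ((1 + h) *\<^sub>R z) - \<psi> (1 *\<^sub>R z)) / h) \<longlongrightarrow> g z \<bullet> z) (at 0)"
        by (simp add: DERIV_def)
      moreover have "filterlim (\<lambda>m. 1 / real (Suc m)) (at 0) sequentially"
        using LIMSEQ_Suc[OF lim_1_over_n] by (auto simp: filterlim_at)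
      ultimately have "(\<lambda>m. (\<psi> ((1 + 1 / real (Suc m)) *\<^sub>R z) - \<psi> (1 *\<^sub>R z)) / (1 / real (Suc m))) \<longlonglongrightarrow> g z \<bullet> z"
        by (rule filterlim_compose)
      then have "(\<lambda>m. (\<psi> ((1 + 1 / real (Suc m)) *\<^sub>R z) - \<psi> (1 *\<^sub>R z)) / (1 / real (Suc m)) * (1 / norm z ^ ?n))
          \<longlonglongrightarrow> g z \<bullet> z * (1 / norm z ^ ?n)"
        by (intro tendsto_mult tendsto_const)
      then show "(\<lambda>m. D m z) \<longlonglongrightarrow> g z \<bullet> z / norm z ^ ?n"
        by (simp add: D_def)
    qed
    show "AE z in lborel. norm (D m z) \<le> w z" for m
    proof (rule AE_I2)
      fix z :: 'a
      define c where "c = 1 + 1 / real (Suc m)"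
      have Dc: "D m z = (\<psi> (c *\<^sub>R z) - \<psi> z) * real (Suc m) / norm z ^ ?n"
        by (simp only: D_def c_def)
      show "norm (D m z) \<le> w z"
      proof (cases "norm z < R")
        case True
        \<comment> \<open>The Lipschitz bound gains a factor 1 / (m + 1), which pays for the
          division by the step.\<close>
        have "\<bar>\<psi> (c *\<^sub>R z) - \<psi> z\<bar> \<le> B * norm (c *\<^sub>R z - z)" by (rule lip)
        also have "c *\<^sub>R z - z = (1 / real (Suc m)) *\<^sub>R z" by (simp add: c_def scaleR_add_left)
        finally have "\<bar>\<psi> (c *\<^sub>R z) - \<psi> z\<bar> * real (Suc m) \<le> B * norm z" by (simp add: field_simps)
        then have "\<bar>\<psi> (c *\<^sub>R z) - \<psi> z\<bar> * real (Suc m) / norm z ^ ?n \<le> B * norm z / norm z ^ ?n"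
          by (rule divide_right_mono) simp
        then show ?thesis using weq[OF True] by (simp add: Dc abs_mult)
      next
        case False
        then have "norm (c *\<^sub>R z) \<ge> R" using mult_right_mono[of 1 c "norm z"] by (auto simp: c_def)
        then have "\<psi> (c *\<^sub>R z) = 0" "\<psi> z = 0" using R False by auto
        then show ?thesis using w0 by (simp add: Dc)
      qed
    qed
    show "D m \<in> borel_measurable lborel" for m unfolding D_def[abs_def] by measurable
  qed (use wi in measurable)
  then have "(\<lambda>m. 0) \<longlonglongrightarrow> (LINT z|lborel. g z \<bullet> z / norm z ^ ?n)" by (simp only: D)
  from LIMSEQ_unique[OF tendsto_const this] show ?thesis by simp
qed

subsection \<open>Truncating the fundamental solution\<close>

text \<open>The test functions are \<open>\<theta>(1 / |y - x|)\<close> for a profile \<open>\<theta>\<close> that is close to \<open>s - 1\<close> up to the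
  constant factor \<open>exp (-1)\<close>, and is supported in \<open>1 + 2\<rho> \<le> s \<le> 1/\<rho>\<close>, that is, away from the unit
  sphere and from the hole.\<close>

definition profile :: "real \<Rightarrow> real \<Rightarrow> real" where
  "profile \<rho> s = (s - (1 + 2 * \<rho>)) * flat_exp ((s - (1 + 2 * \<rho>)) / \<rho>) * flat_exp (1 - \<rho> * s)"

text \<open>At \<open>s = 1 + 2\<rho>\<close> and \<open>s = 1/\<rho>\<close> the divisions by zero are harmless, as \<open>flat_exp\<close> vanishes there.\<close>

definition profile_deriv :: "real \<Rightarrow> real \<Rightarrow> real" where
  "profile_deriv \<rho> s = flat_exp ((s - (1 + 2 * \<rho>)) / \<rho>) * flat_exp (1 - \<rho> * s) *
     (1 + \<rho> / (s - (1 + 2 * \<rho>)) - (s - (1 + 2 * \<rho>)) * \<rho> / (1 - \<rho> * s)\<^sup>2)"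

lemma C_k_on_profile: "C_k_on k UNIV (profile \<rho>)"
proof -
  have lin: "C_k_on k UNIV (\<lambda>s. a * s + b)" for a b :: real
    by (intro C_k_on_add C_k_on_mult C_k_on_const C_k_on_ident open_UNIV)
  define c where "c = 1 + 2 * \<rho>"
  have "C_k_on k UNIV (\<lambda>s. (1 * s + - c) * flat_exp ((1 / \<rho>) * s + - (c / \<rho>)) * flat_exp (- \<rho> * s + 1))"
    by (intro C_k_on_mult[OF open_UNIV] lin C_k_on_compose[OF open_UNIV C_k_on_flat_exp lin] subset_UNIV)
  then show ?thesis
    by (simp add: profile_def[abs_def] c_def[symmetric] diff_divide_distrib)
qed

lemma DERIV_profile:
  assumes "\<rho> > 0"
  shows "(profile \<rho> has_real_derivative profile_deriv \<rho> s) (at s)"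
proof -
  define c where "c = 1 + 2 * \<rho>"
  have prod: "((\<lambda>s. (s - c) * g s * h s) has_real_derivative (g s + (s - c) * G) * h s + (s - c) * g s * H) (at s)"
    if "(g has_real_derivative G) (at s)" "(h has_real_derivative H) (at s)" for g h :: "real \<Rightarrow> real" and G H
    using that by (auto intro!: derivative_eq_intros simp: algebra_simps)
  have "((\<lambda>s. flat_exp ((s - c) / \<rho>)) has_real_derivative
      (flat_exp ((s - c) / \<rho>) / ((s - c) / \<rho>)\<^sup>2) * (1 / \<rho>)) (at s)"
    by (rule DERIV_chain2[OF DERIV_flat_exp]) (use assms in \<open>auto intro!: derivative_eq_intros\<close>)
  moreover have "((\<lambda>s. flat_exp (1 - \<rho> * s)) has_real_derivative
      (flat_exp (1 - \<rho> * s) / (1 - \<rho> * s)\<^sup>2) * (- \<rho>)) (at s)"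
    by (rule DERIV_chain2[OF DERIV_flat_exp]) (auto intro!: derivative_eq_intros)
  ultimately have "((\<lambda>s. (s - c) * flat_exp ((s - c) / \<rho>) * flat_exp (1 - \<rho> * s)) has_real_derivative
      (flat_exp ((s - c) / \<rho>) + (s - c) * ((flat_exp ((s - c) / \<rho>) / ((s - c) / \<rho>)\<^sup>2) * (1 / \<rho>))) * flat_exp (1 - \<rho> * s)
      + (s - c) * flat_exp ((s - c) / \<rho>) * ((flat_exp (1 - \<rho> * s) / (1 - \<rho> * s)\<^sup>2) * (- \<rho>))) (at s)"
    by (rule prod)
  also have "(flat_exp ((s - c) / \<rho>) + (s - c) * ((flat_exp ((s - c) / \<rho>) / ((s - c) / \<rho>)\<^sup>2) * (1 / \<rho>))) * flat_exp (1 - \<rho> * s)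
      + (s - c) * flat_exp ((s - c) / \<rho>) * ((flat_exp (1 - \<rho> * s) / (1 - \<rho> * s)\<^sup>2) * (- \<rho>)) = profile_deriv \<rho> s"
  proof (cases "s = c")
    case True
    then show ?thesis by (simp add: profile_deriv_def c_def flat_exp_def)
  next
    case False
    have "d * ((F / (d / \<rho>)\<^sup>2) * (1 / \<rho>)) = F * (\<rho> / d)" if "d \<noteq> 0" for d F
      using that assms by (simp add: power2_eq_square field_simps)
    from this[of "s - c"] have "(s - c) * ((flat_exp ((s - c) / \<rho>) / ((s - c) / \<rho>)\<^sup>2) * (1 / \<rho>))
        = flat_exp ((s - c) / \<rho>) * (\<rho> / (s - c))"
      using False by simp
    then show ?thesis
      by (simp only: profile_deriv_def c_def[symmetric]) (simp add: algebra_simps)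
  qed
  finally show ?thesis by (simp only: profile_def[abs_def] c_def[symmetric])
qed

lemma profile_eq_0:
  assumes "\<rho> > 0" "s \<le> 1 + 2 * \<rho> \<or> 1 / \<rho> \<le> s"
  shows "profile \<rho> s = 0" "profile_deriv \<rho> s = 0"
proof -
  have "flat_exp ((s - (1 + 2 * \<rho>)) / \<rho>) = 0 \<or> flat_exp (1 - \<rho> * s) = 0"
    using assms by (auto simp: flat_exp_def field_simps)
  then show "profile \<rho> s = 0" "profile_deriv \<rho> s = 0"
    by (auto simp: profile_def profile_deriv_def)
qed

lemma abs_profile_le:
  assumes "\<rho> > 0" "s \<ge> 0"
  shows "\<bar>profile \<rho> s\<bar> \<le> s"
proof (cases "s \<le> 1 + 2 * \<rho>")
  case False
  then have "\<bar>profile \<rho> s\<bar> = (s - (1 + 2 * \<rho>)) * (flat_exp ((s - (1 + 2 * \<rho>)) / \<rho>) * flat_exp (1 - \<rho> * s))"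
    by (simp add: profile_def abs_mult flat_exp_bounds mult.assoc)
  also have "\<dots> \<le> (s - (1 + 2 * \<rho>)) * 1"
    using False by (intro mult_left_mono mult_le_one) (auto simp: flat_exp_bounds)
  finally show ?thesis using assms by simp
qed (use assms profile_eq_0 in simp)

text \<open>The point is uniformity in \<rho>: the exponentials inside \<open>flat_exp\<close>
  absorb the singular quotients. With the abbreviations of the proof, (1 + x) exp(-x) \<le> 1 bounds
  the first term by 1, while y \<le> 1 and w^2 exp(-w) \<le> 4 bound the second by 4.\<close>

lemma abs_profile_deriv_le:
  assumes "\<rho> > 0"
  shows "\<bar>profile_deriv \<rho> s\<bar> \<le> 5"
proof (cases "1 + 2 * \<rho> < s \<and> s < 1 / \<rho>")
  case True
  define x where "x = \<rho> / (s - (1 + 2 * \<rho>))"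
  define w where "w = 1 / (1 - \<rho> * s)"
  define y where "y = (s - (1 + 2 * \<rho>)) * \<rho>"
  have rs: "\<rho> * s < 1" using True assms by (simp add: field_simps)
  have x: "x \<ge> 0" and w: "w \<ge> 0" using True assms rs by (auto simp: x_def w_def)
  have "y \<le> \<rho> * s" using assms by (simp add: y_def algebra_simps)
  then have y: "0 \<le> y" "y \<le> 1" using True assms rs by (simp add: y_def, linarith)
  have F: "flat_exp ((s - (1 + 2 * \<rho>)) / \<rho>) = exp (- x)" "flat_exp (1 - \<rho> * s) = exp (- w)"
    using True assms rs by (auto simp: flat_exp_def x_def w_def)
  have eq: "profile_deriv \<rho> s = exp (- x) * exp (- w) * (1 + x) - exp (- x) * y * (exp (- w) * w\<^sup>2)"
    unfolding profile_deriv_def F x_def[symmetric] y_def[symmetric]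
    by (simp add: w_def power2_eq_square algebra_simps)
  have 1: "exp (- x) * (1 + x) \<le> 1"
    using exp_ge_add_one_self[of x] by (simp add: exp_minus field_simps)
  \<comment> \<open>Squaring w/2 \<le> exp(w/2) yields w^2 \<le> 4 exp(w), the origin of the
    4.\<close>
  have "w / 2 \<le> exp (w / 2)" using exp_ge_add_one_self[of "w / 2"] by linarith
  then have "(w / 2)\<^sup>2 \<le> (exp (w / 2))\<^sup>2" using w by (intro power_mono) auto
  also have "(exp (w / 2))\<^sup>2 = exp w" by (simp add: exp_double[symmetric])
  finally have 2: "exp (- w) * w\<^sup>2 \<le> 4" by (simp add: exp_minus field_simps)
  have "exp (- x) * exp (- w) * (1 + x) = (exp (- x) * (1 + x)) * exp (- w)" by simp
  also have "\<dots> \<le> 1" by (rule mult_le_one[OF 1]) (use w in auto)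
  finally have 3: "exp (- x) * exp (- w) * (1 + x) \<le> 1" .
  have "exp (- x) * y \<le> 1" using x y by (intro mult_le_one) auto
  then have 4: "exp (- x) * y * (exp (- w) * w\<^sup>2) \<le> 1 * 4" using 2 y by (intro mult_mono) auto
  have "0 \<le> exp (- x) * exp (- w) * (1 + x)" "0 \<le> exp (- x) * y * (exp (- w) * w\<^sup>2)"
    using x y by auto
  then show ?thesis unfolding eq using 3 4 by linarith
qed (use assms profile_eq_0 in auto)

text \<open>The argument of the first cutoff tends to infinity, so that factor tends to 1. The
  argument of the second tends to 1, which produces the constant
  \<open>flat_exp 1 = exp (- 1)\<close>. The point \<open>\<sigma>\<close> is allowed to vary
  because the centre of the bump moves.\<close>

lemma tendsto_profile:
  assumes "s > 1" "(\<sigma> \<longlongrightarrow> s) F" "(\<rho> \<longlongrightarrow> 0) F" "eventually (\<lambda>n. \<rho> n > 0) F"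
  shows "((\<lambda>n. profile (\<rho> n) (\<sigma> n)) \<longlongrightarrow> (s - 1) * exp (- 1)) F"
    and "((\<lambda>n. profile_deriv (\<rho> n) (\<sigma> n)) \<longlongrightarrow> exp (- 1)) F"
proof -
  define d where "d n = \<sigma> n - (1 + 2 * \<rho> n)" for n
  define e where "e n = 1 - \<rho> n * \<sigma> n" for n
  have d: "(d \<longlongrightarrow> s - 1) F"
    unfolding d_def[abs_def] using assms by (auto intro!: tendsto_eq_intros)
  have e: "(e \<longlongrightarrow> 1) F"
    unfolding e_def[abs_def] using assms by (auto intro!: tendsto_eq_intros)
  have dpos: "eventually (\<lambda>n. d n > 0) F" using order_tendstoD(1)[OF d, of 0] assms(1) by simp
  have epos: "eventually (\<lambda>n. e n > 0) F" using order_tendstoD(1)[OF e, of 0] by simp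
  have "((\<lambda>n. exp (- (\<rho> n / d n))) \<longlongrightarrow> exp (- (0 / (s - 1)))) F"
    using assms d by (intro tendsto_intros) auto
  then have "((\<lambda>n. exp (- (\<rho> n / d n))) \<longlongrightarrow> 1) F" by simp
  then have F1: "((\<lambda>n. flat_exp (d n / \<rho> n)) \<longlongrightarrow> 1) F"
    by (rule Lim_transform_eventually)
       (use dpos assms(4) in eventually_elim, simp add: flat_exp_def)
  have "((\<lambda>n. exp (- (1 / e n))) \<longlongrightarrow> exp (- (1 / 1))) F"
    using e by (intro tendsto_intros) auto
  then have "((\<lambda>n. exp (- (1 / e n))) \<longlongrightarrow> exp (- 1)) F" by simp
  then have F2: "((\<lambda>n. flat_exp (e n)) \<longlongrightarrow> exp (- 1)) F"
    by (rule Lim_transform_eventually)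
       (use epos in eventually_elim, simp add: flat_exp_def)
  have "((\<lambda>n. d n * flat_exp (d n / \<rho> n) * flat_exp (e n)) \<longlongrightarrow> (s - 1) * 1 * exp (- 1)) F"
    by (intro tendsto_intros d F1 F2)
  then show "((\<lambda>n. profile (\<rho> n) (\<sigma> n)) \<longlongrightarrow> (s - 1) * exp (- 1)) F"
    by (simp add: profile_def d_def e_def)
  have "((\<lambda>n. flat_exp (d n / \<rho> n) * flat_exp (e n) * (1 + \<rho> n / d n - d n * \<rho> n / (e n)\<^sup>2))
      \<longlongrightarrow> 1 * exp (- 1) * (1 + 0 / (s - 1) - (s - 1) * 0 / 1\<^sup>2)) F"
    using assms by (intro tendsto_intros d e F1 F2) auto
  then show "((\<lambda>n. profile_deriv (\<rho> n) (\<sigma> n)) \<longlongrightarrow> exp (- 1)) F"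
    by (simp add: profile_deriv_def d_def e_def)
qed

text \<open>The gradient of \<open>1 / |z|\<close>.\<close>

definition newton_kernel :: "real^3 \<Rightarrow> real^3" where
  "newton_kernel z = - (1 / norm z ^ 3) *\<^sub>R z"

definition bump :: "real \<Rightarrow> real^3 \<Rightarrow> real^3 \<Rightarrow> real" where
  "bump \<rho> x y = profile \<rho> (1 / norm (y - x))"

lemma C_k_on_shift:
  assumes "open S" "C_k_on k S f"
  shows "C_k_on k ((\<lambda>y. y - x) -` S) (\<lambda>y. f (y - x))"
  using assms(2)
proof (induction k arbitrary: f)
  case 0
  then show ?case by (auto intro!: continuous_on_compose2[of S f] continuous_intros)
next
  case (Suc k)
  show ?case
  proof (rule C_k_on_SucI)
    show "open ((\<lambda>y. y - x) -` S)"
      using assms(1) by (intro open_vimage continuous_intros)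
    fix y assume y: "y \<in> (\<lambda>y. y - x) -` S"
    have "((\<lambda>y. y - x) has_derivative (\<lambda>v. v)) (at y)"
      by (auto intro!: derivative_eq_intros)
    from has_derivative_compose[OF this C_k_on_SucD[OF Suc.prems]]
    show "((\<lambda>y. f (y - x)) has_derivative frechet_derivative f (at (y - x))) (at y)"
      using y by simp
  next
    show "C_k_on k ((\<lambda>y. y - x) -` S) (\<lambda>y. frechet_derivative f (at (y - x)) v)" for v
      using Suc.IH[of "\<lambda>z. frechet_derivative f (at z) v"] Suc.prems by simp
  qed
qed

lemma bump_eq_0:
  assumes "\<rho> > 0" "norm (y - x) \<le> \<rho> \<or> 1 / (1 + 2 * \<rho>) \<le> norm (y - x)"
  shows "bump \<rho> x y = 0"
  unfolding bump_def
\<comment> \<open>At the centre \<open>1 / 0 = 0\<close>, which lies in the range where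
  \<open>profile\<close> vanishes, just like the large arguments nearby.\<close>
proof (cases "y = x")
  case False
  then have "0 < norm (y - x)" by simp
  then show "profile \<rho> (1 / norm (y - x)) = 0"
    using assms by (intro profile_eq_0) (auto simp: field_simps)
qed (use assms in \<open>simp add: profile_eq_0\<close>)

text \<open>1 / |y - x| is smooth only off x, but the bump is identically 0 on a ball around x. The
  two open sets cover the space.\<close>

lemma C_k_on_bump:
  assumes "\<rho> > 0"
  shows "C_k_on k UNIV (bump \<rho> x)"
proof -
  have 1: "C_k_on k ((\<lambda>y. y - x) -` (- {0})) (bump \<rho> x)"
    unfolding bump_def[abs_def]
    by (intro C_k_on_compose[OF _ C_k_on_profile] C_k_on_shift[where f="\<lambda>z. 1 / norm z"] C_k_on_inverse_norm)
       (auto intro!: open_vimage continuous_intros)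
  have 2: "C_k_on k (ball x \<rho>) (bump \<rho> x)"
    by (rule C_k_on_cong[OF _ _ C_k_on_const[of k _ 0]])
       (use assms in \<open>auto intro!: bump_eq_0 less_imp_le simp: dist_norm norm_minus_commute\<close>)
  have "C_k_on k ((\<lambda>y. y - x) -` (- {0}) \<union> ball x \<rho>) (bump \<rho> x)"
    by (rule C_k_on_Un[OF _ _ 1 2]) (auto intro!: open_vimage continuous_intros)
  moreover have "(\<lambda>y. y - x) -` (- {0}) \<union> ball x \<rho> = UNIV" using assms by auto
  ultimately show ?thesis by simp
qed

lemma grad_bump:
  assumes "\<rho> > 0"
  shows "grad (bump \<rho> x) y = profile_deriv \<rho> (1 / norm (y - x)) *\<^sub>R newton_kernel (y - x)"
proof (cases "y = x")
  case True
  have "grad (bump \<rho> x) y = 0"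
    by (rule grad_eq_0_outside[where K="- ball x \<rho>"])
       (use True assms in \<open>auto intro!: bump_eq_0 less_imp_le simp: dist_norm norm_minus_commute\<close>)
  then show ?thesis using True by (simp add: newton_kernel_def)
next
  case False
  then have n: "norm (y - x) \<noteq> 0" by simp
  have "((\<lambda>y. norm (y - x)) has_derivative (\<lambda>v. sgn (y - x) \<bullet> v)) (at y)"
  proof -
    have 1: "((\<lambda>y. y - x) has_derivative (\<lambda>v. v)) (at y)"
      by (auto intro!: derivative_eq_intros)
    have 2: "(norm has_derivative (\<lambda>v. sgn (y - x) \<bullet> v)) (at (y - x))"
      using has_derivative_norm[of "y - x"] False by (simp add: inner_commute)
    show ?thesis by (rule has_derivative_compose[OF 1 2])
  qed
  note d = Deriv.has_derivative_inverse[OF n this]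
  have "(\<lambda>h. - (inverse (norm (y - x)) * (sgn (y - x) \<bullet> h) * inverse (norm (y - x))))
      = (\<lambda>v. newton_kernel (y - x) \<bullet> v)"
    by (simp add: fun_eq_iff newton_kernel_def sgn_div_norm power3_eq_cube divide_inverse)
  with d have "((\<lambda>y. 1 / norm (y - x)) has_derivative (\<lambda>v. newton_kernel (y - x) \<bullet> v)) (at y)"
    by (simp add: divide_inverse)
  from has_derivative_compose[OF this DERIV_profile[OF assms, unfolded has_field_derivative_def]]
  have "(bump \<rho> x has_derivative (\<lambda>v. (profile_deriv \<rho> (1 / norm (y - x)) *\<^sub>R newton_kernel (y - x)) \<bullet> v)) (at y)"
    by (simp add: bump_def[abs_def])
  then show ?thesis by (rule grad_eqI)
qed

text \<open>Why the parameter is 2 \<epsilon>: the hole and the centre x both lie in the ball of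
  radius \<epsilon> about 0, so the ball of radius 2 \<epsilon> about x contains the hole. On the
  outer side, |y - x| \<le> 1 / (1 + 4 \<epsilon>) \<le> 1 - \<epsilon> together with |x| <
  \<epsilon> keeps the support inside the unit ball.\<close>

lemma bump_test_function:
  assumes T: "T \<subseteq> ball 0 1" and \<epsilon>: "0 < \<epsilon>" "\<epsilon> \<le> 1 / 2" and x: "norm x < \<epsilon>"
  shows "bump (2 * \<epsilon>) x \<in> test_functions (perforated_ball T \<epsilon>)"
proof (rule test_functionsI[where K="cball x (1 / (1 + 4 * \<epsilon>)) - ball x (2 * \<epsilon>)"])
  show "C_k_on k UNIV (bump (2 * \<epsilon>) x)" for k using \<epsilon> C_k_on_bump by simp
  show "compact (cball x (1 / (1 + 4 * \<epsilon>)) - ball x (2 * \<epsilon>))" by (intro compact_diff) auto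
  show "cball x (1 / (1 + 4 * \<epsilon>)) - ball x (2 * \<epsilon>) \<subseteq> perforated_ball T \<epsilon>"
  proof
    fix y assume y: "y \<in> cball x (1 / (1 + 4 * \<epsilon>)) - ball x (2 * \<epsilon>)"
    then have d: "norm (y - x) \<le> 1 / (1 + 4 * \<epsilon>)" "norm (y - x) \<ge> 2 * \<epsilon>"
      by (auto simp: dist_norm norm_minus_commute)
    have "1 / (1 + 4 * \<epsilon>) \<le> 1 - \<epsilon>"
    proof -
      have "\<epsilon> * \<epsilon> \<le> \<epsilon> * (1/2)" using \<epsilon> by (intro mult_left_mono) auto
      then have "1 \<le> (1 - \<epsilon>) * (1 + 4 * \<epsilon>)" using \<epsilon> by (simp add: algebra_simps)
      then show ?thesis using \<epsilon> by (simp add: divide_le_eq)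
    qed
    then have "norm y < 1" using norm_triangle_sub[of y x] d(1) x by linarith
    moreover have "y \<noteq> \<epsilon> *\<^sub>R t" if "t \<in> T" for t
    proof
      assume "y = \<epsilon> *\<^sub>R t"
      moreover have "norm t < 1" using T that by auto
      ultimately have "norm y < \<epsilon>" using \<epsilon> by simp
      then show False using d(2) x norm_triangle_ineq4[of y x] by linarith
    qed
    ultimately show "y \<in> perforated_ball T \<epsilon>" by (auto simp: perforated_ball_def)
  qed
  show "bump (2 * \<epsilon>) x y = 0" if "y \<notin> cball x (1 / (1 + 4 * \<epsilon>)) - ball x (2 * \<epsilon>)" for y
    using that \<epsilon> by (intro bump_eq_0) (auto simp: dist_norm norm_minus_commute)
qed

subsection \<open>Estimates for weak solutions\<close>

lemma lborel_translate:
  fixes f :: "'a::euclidean_space \<Rightarrow> real"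
  assumes [measurable]: "f \<in> borel_measurable borel"
  shows "integrable lborel (\<lambda>y. f (y - x)) \<longleftrightarrow> integrable lborel f"
    and "(LINT y|lborel. f (y - x)) = (LINT y|lborel. f y)"
proof -
  have *: "f (y - x) = f (- x + y)" for y by simp
  show "integrable lborel (\<lambda>y. f (y - x)) \<longleftrightarrow> integrable lborel f"
    unfolding * by (subst (2) lborel_distr_plus[of "- x", symmetric], subst integrable_distr_eq) auto
  show "(LINT y|lborel. f (y - x)) = (LINT y|lborel. f y)"
    unfolding * by (subst (2) lborel_distr_plus[of "- x", symmetric], subst integral_distr) auto
qed

text \<open>A bridge from \<open>lebesgue_on\<close>, in which the norms are defined, to
  \<open>lborel\<close>, where the majorants are integrated and translated.\<close>

lemma integral_lebesgue_on_le:
  fixes h W :: "'a::euclidean_space \<Rightarrow> real"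
  assumes \<Omega>: "\<Omega> \<in> sets lebesgue" and W: "integrable lborel W" "\<And>y. 0 \<le> W y"
    and h: "h \<in> borel_measurable (lebesgue_on \<Omega>)" "\<And>y. y \<in> \<Omega> \<Longrightarrow> 0 \<le> h y" "\<And>y. y \<in> \<Omega> \<Longrightarrow> h y \<le> W y"
  shows "integrable (lebesgue_on \<Omega>) h" "(LINT y|lebesgue_on \<Omega>. h y) \<le> (LINT y|lborel. W y)"
proof -
  have Wm: "W \<in> borel_measurable lborel" using W(1) by simp
  then have Wi: "integrable lebesgue W" using W(1) integrable_completion by blast
  have "(\<lambda>y. indicator \<Omega> y *\<^sub>R h y) = (\<lambda>y. if y \<in> \<Omega> then h y else 0)" by auto
  then have hm: "(\<lambda>y. indicator \<Omega> y *\<^sub>R h y) \<in> borel_measurable lebesgue"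
    using h(1) borel_measurable_if[OF \<Omega>, of h] by simp
  have le: "norm (indicator \<Omega> y *\<^sub>R h y) \<le> norm (W y)" for y
    using h(2,3)[of y] W(2)[of y] by (auto simp: indicator_def)
  have int: "integrable lebesgue (\<lambda>y. indicator \<Omega> y *\<^sub>R h y)"
    by (rule Bochner_Integration.integrable_bound[OF Wi hm]) (intro AE_I2 le)
  then show "integrable (lebesgue_on \<Omega>) h"
    using \<Omega> by (subst integrable_restrict_space) auto
  have "(LINT y|lebesgue_on \<Omega>. h y) = (LINT y|lebesgue. indicator \<Omega> y *\<^sub>R h y)"
    using \<Omega> by (subst integral_restrict_space) auto
  also have "\<dots> \<le> (LINT y|lebesgue. W y)"
    using le W(2) by (intro integral_mono int Wi) (smt (verit) real_norm_def)
  also have "\<dots> = (LINT y|lborel. W y)"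
    using Wm by (rule integral_completion)
  finally show "(LINT y|lebesgue_on \<Omega>. h y) \<le> (LINT y|lborel. W y)" .
qed

lemma norm_kernel_powr: "norm (newton_kernel z) powr r = norm z powr (- (2 * r))"
proof (cases "z = 0")
  case False
  have "norm (newton_kernel z) = norm z powr (- 2)"
    using False by (simp add: newton_kernel_def powr_minus_divide power3_eq_cube power2_eq_square)
  then show ?thesis by (simp add: powr_powr)
qed (simp add: newton_kernel_def)

lemma borel_measurable_kernel [measurable]: "newton_kernel \<in> borel_measurable borel"
  unfolding newton_kernel_def[abs_def] by measurable

lemma borel_measurable_profile_deriv [measurable]:
  assumes "\<rho> > 0"
  shows "profile_deriv \<rho> \<in> borel_measurable borel"
proof -
  have "profile_deriv \<rho> s = frechet_derivative (profile \<rho>) (at s) 1" for s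
    using frechet_derivative_at[OF DERIV_profile[OF assms, unfolded has_field_derivative_def], of s, symmetric] by simp
  moreover have "continuous_on UNIV (\<lambda>s. frechet_derivative (profile \<rho>) (at s) 1)"
    using C_k_on_profile[of "Suc 0" \<rho>] by simp
  ultimately show ?thesis
    by (intro borel_measurable_continuous_onI) (simp add: fun_eq_iff)
qed

lemma borel_measurable_lebesgue_on_borel:
  "f \<in> borel_measurable borel \<Longrightarrow> f \<in> borel_measurable (lebesgue_on \<Omega>)"
  by (intro measurable_restrict_space1 measurable_completion) simp

lemma kernel_in_Lp:
  assumes r: "0 < r" "2 * r < 3" and \<Omega>: "\<Omega> \<in> sets lebesgue" "\<Omega> \<subseteq> ball x R" "R > 0"
  shows "(\<lambda>y. newton_kernel (y - x)) \<in> Lp r \<Omega>"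
proof -
  define W where "W z = indicator (ball 0 R) z * norm z powr (- (2 * r))" for z :: "real^3"
  have Wi: "integrable lborel W"
    unfolding W_def[abs_def] using r \<Omega> by (intro integrable_norm_powr_ball) auto
  have Wm: "W \<in> borel_measurable borel" using Wi by simp
  have m: "(\<lambda>y. newton_kernel (y - x)) \<in> borel_measurable (lebesgue_on \<Omega>)"
    by (rule borel_measurable_lebesgue_on_borel) measurable
  have "integrable (lebesgue_on \<Omega>) (\<lambda>y. norm (newton_kernel (y - x)) powr r)"
  proof (rule integral_lebesgue_on_le(1)[where W="\<lambda>y. W (y - x)"])
    show "integrable lborel (\<lambda>y. W (y - x))" using Wi lborel_translate[OF Wm] by simp
    show "norm (newton_kernel (y - x)) powr r \<le> W (y - x)" if "y \<in> \<Omega>" for y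
      using that \<Omega> by (auto simp: W_def norm_kernel_powr dist_norm norm_minus_commute)
    show "(\<lambda>y. norm (newton_kernel (y - x)) powr r) \<in> borel_measurable (lebesgue_on \<Omega>)"
      using m by measurable
  qed (auto simp: W_def \<Omega>)
  then show ?thesis using m by (simp add: Lp_def)
qed

section \<open>Weak gradients are orthogonal to the kernel\<close>

text \<open>Since x lies outside \<Omega>, \<open>\<psi>\<close> vanishes at x. Translating x to the
  origin reduces the claim to \<open>integral_grad_kernel_eq_0\<close> in dimension 3.\<close>

lemma test_function_kernel_orthogonal:
  fixes \<Omega> :: "(real^3) set"
  assumes \<psi>: "\<psi> \<in> test_functions \<Omega>" and \<Omega>: "open \<Omega>" and x: "x \<notin> \<Omega>"
  shows "(LINT y|lebesgue_on \<Omega>. newton_kernel (y - x) \<bullet> grad \<psi> y) = 0"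
proof -
  obtain K B where K: "compact K" "K \<subseteq> \<Omega>" "\<And>y. y \<notin> K \<Longrightarrow> \<psi> y = 0" "\<And>y. y \<notin> K \<Longrightarrow> grad \<psi> y = 0"
    and B: "\<And>y. norm (grad \<psi> y) \<le> B" "B > 0"
    using test_function_grad[OF \<psi>] by metis
  have gm[measurable]: "grad \<psi> \<in> borel_measurable borel"
    using continuous_grad test_functionsD(1)[OF \<psi>] borel_measurable_continuous_onI by blast
  obtain R where R: "R > 0" "K \<subseteq> ball x R"
    using compact_imp_bounded[OF K(1)] bounded_subset_ballD[of K x] by auto
  have "(LINT y|lebesgue_on \<Omega>. newton_kernel (y - x) \<bullet> grad \<psi> y)
      = (LINT y|lebesgue. indicator \<Omega> y *\<^sub>R (newton_kernel (y - x) \<bullet> grad \<psi> y))"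
    using \<Omega> by (subst integral_restrict_space) auto
  also have "\<dots> = (LINT y|lebesgue. newton_kernel (y - x) \<bullet> grad \<psi> y)"
  proof (intro Bochner_Integration.integral_cong refl)
    show "indicator \<Omega> y *\<^sub>R (newton_kernel (y - x) \<bullet> grad \<psi> y) = newton_kernel (y - x) \<bullet> grad \<psi> y" for y
      using K(2) K(4)[of y] by (cases "y \<in> K") auto
  qed
  also have "\<dots> = (LINT y|lborel. newton_kernel (y - x) \<bullet> grad \<psi> y)"
    by (rule integral_completion) measurable
  also have "\<dots> = (LINT z|lborel. newton_kernel z \<bullet> grad \<psi> (x + z))"
    using lborel_translate(2)[of "\<lambda>z. newton_kernel z \<bullet> grad \<psi> (x + z)" x] by simp
  also have "\<dots> = - (LINT z|lborel. grad \<psi> (x + z) \<bullet> z / norm z ^ DIM(real^3))"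
    by (simp add: newton_kernel_def inner_commute flip: Bochner_Integration.integral_minus)
  also have "(LINT z|lborel. grad \<psi> (x + z) \<bullet> z / norm z ^ DIM(real^3)) = 0"
  proof (rule integral_grad_kernel_eq_0[where \<psi>="\<lambda>z. \<psi> (x + z)" and B=B and R=R])
    show "((\<lambda>z. \<psi> (x + z)) has_derivative (\<lambda>v. grad \<psi> (x + z) \<bullet> v)) (at z)" for z
    proof (rule has_derivative_compose[of "\<lambda>z. x + z" "\<lambda>v. v"])
      show "((\<lambda>z. x + z) has_derivative (\<lambda>v. v)) (at z)" by (auto intro!: derivative_eq_intros)
      show "(\<psi> has_derivative (\<lambda>v. grad \<psi> (x + z) \<bullet> v)) (at (x + z))"
        using C_k_has_derivative_grad test_functionsD(1)[OF \<psi>] by blast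
    qed
    show "\<psi> (x + z) = 0" if "R \<le> norm z" for z
      using that R(2) by (intro K(3)) (auto simp: subset_eq dist_norm)
    show "\<psi> (x + 0) = 0" using x K(2,3) by auto
  qed (use B R in auto)
  finally show ?thesis by simp
qed

text \<open>This is where the zero boundary values on the hole enter: \<open>W1p_0\<close> supplies
  approximations that vanish at x.\<close>

lemma W1p_0_kernel_orthogonal:
  fixes \<Omega> :: "(real^3) set"
  assumes p: "p > 3" and u: "u \<in> W1p_0 p \<Omega>" and \<Omega>: "open \<Omega>" "\<Omega> \<subseteq> ball x R" "R > 0" and x: "x \<notin> \<Omega>"
  shows "(LINT y|lebesgue_on \<Omega>. weak_grad \<Omega> u y \<bullet> newton_kernel (y - x)) = 0"
proof -
  define r where "r = p / (p - 1)"
  have r: "r > 1" "2 * r < 3" "1 / p + 1 / r = 1"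
    using p by (auto simp: r_def field_simps)
  have \<Omega>s: "\<Omega> \<in> sets lebesgue" using \<Omega> by simp
  have \<Omega>m: "\<Omega> \<in> lmeasurable"
    using \<Omega> by (intro lmeasurable_open) (auto intro: bounded_subset)
  obtain \<phi> where \<phi>: "\<And>n. \<phi> n \<in> test_functions \<Omega>"
    and lim: "(\<lambda>n. Lp_norm p \<Omega> (\<lambda>y. grad (\<phi> n) y - weak_grad \<Omega> u y)) \<longlonglongrightarrow> 0"
    using u by (auto simp: W1p_0_def)
  have K: "(\<lambda>y. newton_kernel (y - x)) \<in> Lp r \<Omega>"
    using r \<Omega> \<Omega>s by (intro kernel_in_Lp) auto
  have wg: "weak_grad \<Omega> u \<in> Lp p \<Omega>"
    using u \<Omega> by (intro weak_grad_in_Lp) (auto simp: W1p_0_def)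
  have g: "grad (\<phi> n) \<in> Lp p \<Omega>" for n
    using grad_in_Lp[OF \<phi> \<Omega>m] p by simp
  have diff: "(\<lambda>y. grad (\<phi> n) y - weak_grad \<Omega> u y) \<in> Lp p \<Omega>" for n
    using Lp_diff[OF _ g wg] p by simp
  define I where "I = (LINT y|lebesgue_on \<Omega>. weak_grad \<Omega> u y \<bullet> newton_kernel (y - x))"
  \<comment> \<open>The approximating gradients contribute 0, so integrating the difference of
    gradients against the kernel gives -I for every \<open>n\<close>; Hoelder bounds it by a null
    sequence.\<close>
  have bound: "\<bar>I\<bar> \<le> Lp_norm p \<Omega> (\<lambda>y. grad (\<phi> n) y - weak_grad \<Omega> u y) * Lp_norm r \<Omega> (\<lambda>y. newton_kernel (y - x))" for n
  proof -
    have int: "integrable (lebesgue_on \<Omega>) (\<lambda>y. grad (\<phi> n) y \<bullet> newton_kernel (y - x))"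
      "integrable (lebesgue_on \<Omega>) (\<lambda>y. weak_grad \<Omega> u y \<bullet> newton_kernel (y - x))"
      using Lp_Hoelder(1)[OF _ r(1,3) g K] Lp_Hoelder(1)[OF _ r(1,3) wg K] p by auto
    have "(LINT y|lebesgue_on \<Omega>. (grad (\<phi> n) y - weak_grad \<Omega> u y) \<bullet> newton_kernel (y - x))
        = (LINT y|lebesgue_on \<Omega>. grad (\<phi> n) y \<bullet> newton_kernel (y - x)) - I"
      unfolding inner_diff_left I_def by (rule Bochner_Integration.integral_diff[OF int])
    also have "(LINT y|lebesgue_on \<Omega>. grad (\<phi> n) y \<bullet> newton_kernel (y - x)) = 0"
      using test_function_kernel_orthogonal[OF \<phi> \<Omega>(1) x] by (simp add: inner_commute)
    finally have "(LINT y|lebesgue_on \<Omega>. (grad (\<phi> n) y - weak_grad \<Omega> u y) \<bullet> newton_kernel (y - x)) = - I"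
      by simp
    then show ?thesis
      using Lp_Hoelder(2)[OF _ r(1,3) diff K, of n] p by simp
  qed
  have "(\<lambda>n. Lp_norm p \<Omega> (\<lambda>y. grad (\<phi> n) y - weak_grad \<Omega> u y) * Lp_norm r \<Omega> (\<lambda>y. newton_kernel (y - x)))
      \<longlonglongrightarrow> 0 * Lp_norm r \<Omega> (\<lambda>y. newton_kernel (y - x))"
    by (intro tendsto_mult lim tendsto_const)
  then have "\<bar>I\<bar> \<le> 0 * Lp_norm r \<Omega> (\<lambda>y. newton_kernel (y - x))"
    by (rule LIMSEQ_le_const) (use bound in auto)
  then show ?thesis by (simp add: I_def)
qed

section \<open>Convergence of the truncated gradients\<close>

text \<open>\<open>truncation_error r \<rho>\<close> integrates over a ball slightly larger than the unit ball because the
  domain is recentred at a point of the hole.\<close>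

definition truncation_error :: "real \<Rightarrow> real \<Rightarrow> real" where
  "truncation_error r \<rho> = (LINT z|lborel. indicator (ball 0 (1 + \<rho>)) z *
     norm ((profile_deriv \<rho> (1 / norm z) - exp (- 1)) *\<^sub>R newton_kernel z) powr r)"

lemma truncation_integrand_le:
  assumes "\<rho> > 0" "r > 0"
  shows "norm ((profile_deriv \<rho> (1 / norm z) - exp (- 1)) *\<^sub>R newton_kernel z) powr r
    \<le> 6 powr r * norm z powr (- (2 * r))"
proof -
  \<comment> \<open>6 is the 5 of \<open>abs_profile_deriv_le\<close> plus 1 as a bound for
    exp(-1).\<close>
  have "\<bar>profile_deriv \<rho> (1 / norm z) - exp (- 1)\<bar> \<le> 6"
    using abs_profile_deriv_le[OF assms(1), of "1 / norm z"] exp_le_one_iff[of "-1"] by (smt (verit) exp_gt_zero)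
  then have "norm ((profile_deriv \<rho> (1 / norm z) - exp (- 1)) *\<^sub>R newton_kernel z) powr r \<le> (6 * norm (newton_kernel z)) powr r"
    using assms(2) by (intro powr_mono2) (auto intro: mult_right_mono)
  then show ?thesis by (simp add: powr_mult norm_kernel_powr)
qed

lemma borel_measurable_truncation_integrand:
  assumes "\<rho> > 0"
  shows "(\<lambda>z. indicator (ball 0 (1 + \<rho>)) z *
     norm ((profile_deriv \<rho> (1 / norm z) - exp (- 1)) *\<^sub>R newton_kernel z) powr r) \<in> borel_measurable borel"
proof -
  have [measurable]: "ball (0::real^3) (1 + \<rho>) \<in> sets borel" by simp
  show ?thesis using borel_measurable_profile_deriv[OF assms] by measurable
qed

lemma integrable_truncation_integrand:
  assumes "0 < \<rho>" "0 < r" "2 * r < 3"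
  shows "integrable lborel (\<lambda>z. indicator (ball 0 (1 + \<rho>)) z *
     norm ((profile_deriv \<rho> (1 / norm z) - exp (- 1)) *\<^sub>R newton_kernel z) powr r)"
proof (rule Bochner_Integration.integrable_bound)
  show "integrable lborel (\<lambda>z::real^3. 6 powr r * (indicator (ball 0 (1 + \<rho>)) z * norm z powr (- (2 * r))))"
    using assms by (intro integrable_mult_right integrable_norm_powr_ball) auto
  show "(\<lambda>z. indicator (ball 0 (1 + \<rho>)) z *
     norm ((profile_deriv \<rho> (1 / norm z) - exp (- 1)) *\<^sub>R newton_kernel z) powr r) \<in> borel_measurable lborel"
    using borel_measurable_truncation_integrand[OF assms(1)] by simp
  show "AE z in lborel. norm (indicator (ball 0 (1 + \<rho>)) z * norm ((profile_deriv \<rho> (1 / norm z) - exp (- 1)) *\<^sub>R newton_kernel z) powr r)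
      \<le> norm (6 powr r * (indicator (ball 0 (1 + \<rho>)) z * norm z powr (- (2 * r))))"
    using truncation_integrand_le[OF assms(1,2)] by (intro AE_I2) (auto simp: indicator_def)
qed

lemma tendsto_truncation_error:
  assumes r: "0 < r" "2 * r < 3" and \<rho>: "\<And>n. 0 < \<rho> n" "\<And>n. \<rho> n \<le> 1" "\<rho> \<longlonglongrightarrow> 0"
  shows "(\<lambda>n. truncation_error r (\<rho> n)) \<longlonglongrightarrow> 0"
proof -
  define E where "E n z = indicator (ball 0 (1 + \<rho> n)) z *
     norm ((profile_deriv (\<rho> n) (1 / norm z) - exp (- 1)) *\<^sub>R newton_kernel z) powr r" for n z
  have "(\<lambda>n. LINT z|lborel. E n z) \<longlonglongrightarrow> (LINT z|(lborel::(real^3) measure). 0)"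
  proof (rule integral_dominated_convergence[where w="\<lambda>z. 6 powr r * (indicator (ball 0 2) z * norm z powr (- (2 * r)))"])
    show "E n \<in> borel_measurable lborel" for n
      unfolding E_def[abs_def] using borel_measurable_truncation_integrand[OF \<rho>(1)] by simp
    show "integrable lborel (\<lambda>z::real^3. 6 powr r * (indicator (ball 0 2) z * norm z powr (- (2 * r))))"
      using r by (intro integrable_mult_right integrable_norm_powr_ball) auto
    show "AE z in lborel. norm (E n z) \<le> 6 powr r * (indicator (ball 0 2) z * norm z powr (- (2 * r)))" for n
      using truncation_integrand_le[OF \<rho>(1) r(1)] \<rho>(2)[of n] by (intro AE_I2) (auto simp: E_def indicator_def)
    \<comment> \<open>On the unit sphere \<open>profile_deriv\<close> is 0 for every
      \<open>n\<close>, so the integrand stays at \<open>exp (- 1) powr r\<close>; only its being a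
      null set helps. Inside, the scalar factor tends to 0; outside, the point eventually leaves the
      shrinking ball.\<close>
    have "AE z in lborel. z \<notin> sphere (0::real^3) 1"
    proof (rule AE_not_in)
      show "sphere (0::real^3) 1 \<in> null_sets lborel"
        using negligible_sphere[of "0::real^3" 1]
        by (auto simp: null_sets_completion_iff negligible_iff_null_sets)
    qed
    then show "AE z in lborel. (\<lambda>n. E n z) \<longlonglongrightarrow> 0"
    proof (eventually_elim)
      fix z :: "real^3" assume z: "z \<notin> sphere 0 1"
      then consider "z = 0" | "z \<noteq> 0" "norm z < 1" | "norm z > 1" by fastforce
      then show "(\<lambda>n. E n z) \<longlonglongrightarrow> 0"
      proof cases
        case 1
        then show ?thesis using r by (simp add: E_def newton_kernel_def)
      next
        case 2
        have "(\<lambda>n. profile_deriv (\<rho> n) (1 / norm z)) \<longlonglongrightarrow> exp (- 1)"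
          using 2 \<rho> by (intro tendsto_profile(2)[where s="1 / norm z"]) auto
        then have "(\<lambda>n. norm ((profile_deriv (\<rho> n) (1 / norm z) - exp (- 1)) *\<^sub>R newton_kernel z)) \<longlonglongrightarrow> norm ((exp (- 1) - exp (- 1)) *\<^sub>R newton_kernel z)"
          by (intro tendsto_intros)
        then have "(\<lambda>n. norm ((profile_deriv (\<rho> n) (1 / norm z) - exp (- 1)) *\<^sub>R newton_kernel z) powr r) \<longlonglongrightarrow> 0 powr r"
          using r by (intro tendsto_powr2) auto
        then have "(\<lambda>n. norm ((profile_deriv (\<rho> n) (1 / norm z) - exp (- 1)) *\<^sub>R newton_kernel z) powr r) \<longlonglongrightarrow> 0"
          by simp
        then show ?thesis
        proof (rule Lim_null_comparison[rotated])
          show "\<forall>\<^sub>F n in sequentially. norm (E n z) \<le> norm ((profile_deriv (\<rho> n) (1 / norm z) - exp (- 1)) *\<^sub>R newton_kernel z) powr r"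
            by (intro always_eventually allI) (auto simp: E_def indicator_def)
        qed
      next
        case 3
        have "\<forall>\<^sub>F n in sequentially. \<rho> n < norm z - 1"
          using order_tendstoD(2)[OF \<rho>(3)] 3 by simp
        then have "\<forall>\<^sub>F n in sequentially. E n z = 0"
          by eventually_elim (simp add: E_def)
        then show ?thesis by (rule tendsto_eventually)
      qed
    qed
  qed simp
  then show ?thesis by (simp add: truncation_error_def E_def)
qed

text \<open>Both gradients are multiples of the same kernel centred at x. After translation the
  bound depends on neither x nor \<Omega>, which leaves a limit in the single parameter
  \<rho>.\<close>

lemma Lp_norm_truncation_le:
  assumes r: "0 < r" "2 * r < 3" and \<rho>: "\<rho> > 0" and \<Omega>: "\<Omega> \<in> sets lebesgue" "\<Omega> \<subseteq> ball x (1 + \<rho>)"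
  shows "Lp_norm r \<Omega> (\<lambda>y. grad (bump \<rho> x) y - exp (- 1) *\<^sub>R newton_kernel (y - x)) \<le> truncation_error r \<rho> powr (1 / r)"
proof -
  define W where "W z = indicator (ball 0 (1 + \<rho>)) z *
     norm ((profile_deriv \<rho> (1 / norm z) - exp (- 1)) *\<^sub>R newton_kernel z) powr r" for z
  have Wi: "integrable lborel W" unfolding W_def[abs_def] by (rule integrable_truncation_integrand[OF \<rho> r])
  have Wm: "W \<in> borel_measurable borel" using Wi by simp
  have eq: "grad (bump \<rho> x) y - exp (- 1) *\<^sub>R newton_kernel (y - x)
      = (profile_deriv \<rho> (1 / norm (y - x)) - exp (- 1)) *\<^sub>R newton_kernel (y - x)" for y
    using \<rho> by (simp add: grad_bump scaleR_diff_left)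
  have "(LINT y|lebesgue_on \<Omega>. norm (grad (bump \<rho> x) y - exp (- 1) *\<^sub>R newton_kernel (y - x)) powr r)
      \<le> (LINT y|lborel. W (y - x))"
  proof (rule integral_lebesgue_on_le(2)[OF \<Omega>(1)])
    show "integrable lborel (\<lambda>y. W (y - x))" using Wi lborel_translate[OF Wm] by simp
    show "(\<lambda>y. norm (grad (bump \<rho> x) y - exp (- 1) *\<^sub>R newton_kernel (y - x)) powr r) \<in> borel_measurable (lebesgue_on \<Omega>)"
      unfolding eq by (rule borel_measurable_lebesgue_on_borel) (use borel_measurable_profile_deriv[OF \<rho>] in measurable)
    show "norm (grad (bump \<rho> x) y - exp (- 1) *\<^sub>R newton_kernel (y - x)) powr r \<le> W (y - x)" if "y \<in> \<Omega>" for y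
      unfolding eq using that \<Omega>(2) by (auto simp: W_def dist_norm norm_minus_commute subset_eq)
  qed (auto simp: W_def)
  also have "\<dots> = truncation_error r \<rho>"
    using lborel_translate(2)[OF Wm] by (simp add: truncation_error_def W_def)
  finally show ?thesis
    unfolding Lp_norm_def using r by (intro powr_mono2) auto
qed

section \<open>Convergence of the truncated potentials\<close>

text \<open>A majorant centred at 0, the same for all \<epsilon> and x. Where |y - x| \<le> 2
  \<epsilon> the bump is 0; elsewhere |x| < \<epsilon> gives |y| \<le> 2 |y - x|, the origin of the
  factor 2.\<close>

lemma abs_bump_le:
  assumes "norm x < \<epsilon>"
  shows "\<bar>bump (2 * \<epsilon>) x y\<bar> \<le> 2 / norm y"
proof (cases "norm (y - x) \<le> 2 * \<epsilon>")
  case True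
  have "\<epsilon> > 0" using assms norm_ge_zero[of x] by linarith
  then show ?thesis using bump_eq_0[of "2 * \<epsilon>" y x] True by simp
next
  case False
  have e: "\<epsilon> > 0" using assms norm_ge_zero[of x] by linarith
  have y: "norm y > 0" "norm y \<le> 2 * norm (y - x)"
    using False assms e norm_triangle_ineq4[of y x] norm_triangle_sub[of y x] by linarith+
  have "\<bar>bump (2 * \<epsilon>) x y\<bar> \<le> 1 / norm (y - x)"
    unfolding bump_def using e by (intro abs_profile_le) auto
  also have "\<dots> \<le> 2 / norm y" using frac_le[of 2 2 "norm y" "2 * norm (y - x)"] y by simp
  finally show ?thesis .
qed

lemma tendsto_bump:
  assumes y: "y \<noteq> 0" "norm y < 1" and x: "\<And>n. norm (x n) < \<epsilon> n" and "\<epsilon> \<longlonglongrightarrow> 0"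
  shows "(\<lambda>n. bump (2 * \<epsilon> n) (x n) y) \<longlonglongrightarrow> (1 / norm y - 1) * exp (- 1)"
  unfolding bump_def
proof (rule tendsto_profile(1))
  have "x \<longlonglongrightarrow> 0"
    using x by (intro Lim_null_comparison[OF _ assms(4)]) (auto intro!: always_eventually less_imp_le)
  then have "(\<lambda>n. 1 / norm (y - x n)) \<longlonglongrightarrow> 1 / norm (y - 0)"
    using y by (intro tendsto_intros) auto
  then show "(\<lambda>n. 1 / norm (y - x n)) \<longlonglongrightarrow> 1 / norm y" by simp
  show "(\<lambda>n. 2 * \<epsilon> n) \<longlonglongrightarrow> 0" using tendsto_mult_left[OF assms(4), of 2] by simp
  have "0 < \<epsilon> n" for n using x[of n] norm_ge_zero[of "x n"] by linarith
  then show "\<forall>\<^sub>F n in sequentially. 0 < 2 * \<epsilon> n" by simp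
qed (use y in auto)

lemma tendsto_bump_integral:
  assumes d: "integrable (lebesgue_on (ball 0 1)) d"
    and Gd: "integrable (lebesgue_on (ball 0 1)) (\<lambda>y. (1 / norm y - 1) * d y)"
    and x: "\<And>n. norm (x n) < \<epsilon> n" and "\<epsilon> \<longlonglongrightarrow> 0"
  shows "(\<lambda>n. LINT y|lebesgue_on (ball 0 1). d y * bump (2 * \<epsilon> n) (x n) y)
    \<longlonglongrightarrow> exp (- 1) * (LINT y|lebesgue_on (ball 0 1). (1 / norm y - 1) * d y)"
proof -
  have e: "0 < \<epsilon> n" for n using x[of n] norm_ge_zero[of "x n"] by linarith
  have "(\<lambda>n. LINT y|lebesgue_on (ball 0 1). d y * bump (2 * \<epsilon> n) (x n) y)
    \<longlonglongrightarrow> (LINT y|lebesgue_on (ball 0 1). exp (- 1) * ((1 / norm y - 1) * d y))"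
  \<comment> \<open>The majorant 2 |d(y)| / |y| of \<open>abs_bump_le\<close> is traded for the two
    functions known to be integrable, through 1 / |y| \<le> |1 / |y| - 1| + 1.\<close>
  proof (rule integral_dominated_convergence[where w="\<lambda>y. 2 * (norm ((1 / norm y - 1) * d y) + norm (d y))"])
    show "integrable (lebesgue_on (ball 0 1)) (\<lambda>y. 2 * (norm ((1 / norm y - 1) * d y) + norm (d y)))"
      by (intro integrable_mult_right Bochner_Integration.integrable_add integrable_norm d Gd)
    show "(\<lambda>y. exp (- 1) * ((1 / norm y - 1) * d y)) \<in> borel_measurable (lebesgue_on (ball 0 1))"
      by (rule borel_measurable_times[OF borel_measurable_const borel_measurable_integrable[OF Gd]])
    have "continuous_on UNIV (bump (2 * \<epsilon> n) (x n))" for n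
      using C_k_on_bump[of "2 * \<epsilon> n" 0 "x n"] e[of n] by simp
    then have "bump (2 * \<epsilon> n) (x n) \<in> borel_measurable (lebesgue_on (ball 0 1))" for n
      by (intro borel_measurable_lebesgue_on_borel borel_measurable_continuous_onI)
    then show "(\<lambda>y. d y * bump (2 * \<epsilon> n) (x n) y) \<in> borel_measurable (lebesgue_on (ball 0 1))" for n
      using d by (intro borel_measurable_times) auto
    have "AE y in lebesgue_on (ball 0 1). y \<noteq> (0::real^3)"
      using AE_completion[OF AE_lborel_singleton[of "0::real^3"]]
      by (subst AE_restrict_space_iff) (auto elim: eventually_mono)
    moreover have "AE y in lebesgue_on (ball 0 1). y \<in> ball (0::real^3) 1"
      by (rule AE_I2) simp
    ultimately show "AE y in lebesgue_on (ball 0 1). (\<lambda>n. d y * bump (2 * \<epsilon> n) (x n) y)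
        \<longlonglongrightarrow> exp (- 1) * ((1 / norm y - 1) * d y)"
    proof eventually_elim
      case (elim y)
      then have "(\<lambda>n. d y * bump (2 * \<epsilon> n) (x n) y) \<longlonglongrightarrow> d y * ((1 / norm y - 1) * exp (- 1))"
        by (intro tendsto_mult tendsto_const tendsto_bump x assms(4)) auto
      then show ?case by (simp add: mult_ac)
    qed
    show "AE y in lebesgue_on (ball 0 1). norm (d y * bump (2 * \<epsilon> n) (x n) y)
        \<le> 2 * (norm ((1 / norm y - 1) * d y) + norm (d y))" for n
    proof (rule AE_I2)
      fix y :: "real^3"
      have "norm (d y * bump (2 * \<epsilon> n) (x n) y) \<le> \<bar>d y\<bar> * (2 / norm y)"
        unfolding real_norm_def abs_mult by (intro mult_left_mono abs_bump_le x abs_ge_zero)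
      also have "\<dots> \<le> \<bar>d y\<bar> * (2 * (\<bar>1 / norm y - 1\<bar> + 1))"
      proof (rule mult_left_mono)
        have "1 / norm y \<le> \<bar>1 / norm y - 1\<bar> + 1" by linarith
        then show "2 / norm y \<le> 2 * (\<bar>1 / norm y - 1\<bar> + 1)" by simp
      qed simp
      finally show "norm (d y * bump (2 * \<epsilon> n) (x n) y) \<le> 2 * (norm ((1 / norm y - 1) * d y) + norm (d y))"
        unfolding real_norm_def abs_mult by (simp add: distrib_left mult_ac)
    qed
  qed
  then show ?thesis by simp
qed

section \<open>The duality estimate and the conclusion\<close>

lemma perforated_ball_open:
  assumes "closed T" "T \<subseteq> ball 0 1"
  shows "open (perforated_ball T \<epsilon>)"
proof -
  have "compact T"
    using assms bounded_subset[OF bounded_ball] compact_eq_bounded_closed by blast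
  then have "compact ((\<lambda>x. \<epsilon> *\<^sub>R x) ` T)"
    by (rule compact_scaling)
  then show ?thesis
    unfolding perforated_ball_def by (intro open_Diff compact_imp_closed) auto
qed

text \<open>By orthogonality, \<open>exp (- 1)\<close> times the kernel can be subtracted from the
  gradient of the bump at no cost. This replaces a factor of order one in Hoelder's inequality by
  one that tends to 0 with \<epsilon>, and it does so whatever the solution is.\<close>

lemma weak_solution_bump_le:
  fixes T :: "(real^3) set"
  assumes T: "closed T" "T \<subseteq> ball 0 1" and p: "p > 3"
    and div: "has_distributional_divergence (ball 0 1) f d"
    and sol: "weak_solution p (perforated_ball T \<epsilon>) f u"
    and \<epsilon>: "0 < \<epsilon>" "\<epsilon> \<le> 1 / 2" and x: "x \<in> T"
  shows "\<bar>LINT y|lebesgue_on (ball 0 1). d y * bump (2 * \<epsilon>) (\<epsilon> *\<^sub>R x) y\<bar>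
    \<le> Lp_norm p (perforated_ball T \<epsilon>) (weak_grad (perforated_ball T \<epsilon>) u)
      * truncation_error (p / (p - 1)) (2 * \<epsilon>) powr (1 / (p / (p - 1)))"
proof -
  define r where "r = p / (p - 1)"
  have r: "r > 1" "2 * r < 3" "1 / p + 1 / r = 1"
    using p by (auto simp: r_def field_simps)
  define \<Omega> where "\<Omega> = perforated_ball T \<epsilon>"
  define w where "w = weak_grad \<Omega> u"
  define \<phi> where "\<phi> = bump (2 * \<epsilon>) (\<epsilon> *\<^sub>R x)"
  have \<Omega>o: "open \<Omega>" unfolding \<Omega>_def by (rule perforated_ball_open[OF T])
  then have \<Omega>s: "\<Omega> \<in> sets lebesgue" by simp
  have sub: "\<Omega> \<subseteq> ball 0 1" by (auto simp: \<Omega>_def perforated_ball_def)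
  have \<Omega>m: "\<Omega> \<in> lmeasurable"
    using \<Omega>o sub by (intro lmeasurable_open) (auto intro: bounded_subset)
  have "norm x < 1" using T(2) x by auto
  then have nx: "norm (\<epsilon> *\<^sub>R x) < \<epsilon>" using \<epsilon> by simp
  have xn: "\<epsilon> *\<^sub>R x \<notin> \<Omega>" using x by (auto simp: \<Omega>_def perforated_ball_def)
  have sub': "\<Omega> \<subseteq> ball (\<epsilon> *\<^sub>R x) (1 + 2 * \<epsilon>)"
  proof
    fix y assume "y \<in> \<Omega>"
    then have "norm y < 1" using sub by auto
    then show "y \<in> ball (\<epsilon> *\<^sub>R x) (1 + 2 * \<epsilon>)"
      using norm_triangle_ineq4[of "\<epsilon> *\<^sub>R x" y] nx \<epsilon> unfolding mem_ball dist_norm by linarith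
  qed
  have \<phi>: "\<phi> \<in> test_functions \<Omega>"
    unfolding \<phi>_def \<Omega>_def by (rule bump_test_function[OF T(2) \<epsilon> nx])
  then have \<phi>B: "\<phi> \<in> test_functions (ball 0 1)"
    using sub by (auto simp: test_functions_def)
  obtain K where K: "K \<subseteq> \<Omega>" "\<And>y. y \<notin> K \<Longrightarrow> grad \<phi> y = 0"
    using test_function_grad[OF \<phi>] by metis
  have u: "u \<in> W1p_0 p \<Omega>"
    and weq: "(LINT y|lebesgue_on \<Omega>. w y \<bullet> grad \<phi> y) = - (LINT y|lebesgue_on \<Omega>. f y \<bullet> grad \<phi> y)"
    using sol \<phi> by (auto simp: weak_solution_def \<Omega>_def[symmetric] w_def)
  \<comment> \<open>The equation lives on \<Omega> but the divergence of f on the ball. The two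
    integrals agree because the gradient of \<open>\<phi>\<close> vanishes off a subset of
    \<Omega>.\<close>
  have "(LINT y|lebesgue_on \<Omega>. f y \<bullet> grad \<phi> y) = (LINT y|lebesgue. indicator \<Omega> y *\<^sub>R (f y \<bullet> grad \<phi> y))"
    using \<Omega>s by (subst integral_restrict_space) auto
  also have "\<dots> = (LINT y|lebesgue. indicator (ball 0 1) y *\<^sub>R (f y \<bullet> grad \<phi> y))"
  proof (intro Bochner_Integration.integral_cong refl)
    show "indicator \<Omega> y *\<^sub>R (f y \<bullet> grad \<phi> y) = indicator (ball 0 1) y *\<^sub>R (f y \<bullet> grad \<phi> y)" for y
      using K(1) K(2)[of y] sub by (cases "y \<in> K") (auto simp: indicator_def)
  qed
  also have "\<dots> = (LINT y|lebesgue_on (ball 0 1). f y \<bullet> grad \<phi> y)"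
    by (subst integral_restrict_space) auto
  also have "\<dots> = - (LINT y|lebesgue_on (ball 0 1). d y * \<phi> y)"
    using div \<phi>B by (auto simp: has_distributional_divergence_def)
  finally have eq: "(LINT y|lebesgue_on (ball 0 1). d y * \<phi> y) = (LINT y|lebesgue_on \<Omega>. w y \<bullet> grad \<phi> y)"
    using weq by simp
  have w: "w \<in> Lp p \<Omega>"
    unfolding w_def using u \<Omega>o by (intro weak_grad_in_Lp) (auto simp: W1p_0_def)
  have g: "grad \<phi> \<in> Lp r \<Omega>"
    using grad_in_Lp[OF \<phi> \<Omega>m] r by simp
  have "(\<lambda>y. newton_kernel (y - \<epsilon> *\<^sub>R x)) \<in> Lp r \<Omega>"
    using kernel_in_Lp[OF _ r(2) \<Omega>s sub'] r \<epsilon> by simp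
  then have k: "(\<lambda>y. exp (- 1) *\<^sub>R newton_kernel (y - \<epsilon> *\<^sub>R x)) \<in> Lp r \<Omega>"
    by (auto simp: Lp_def powr_mult)
  have "(LINT y|lebesgue_on \<Omega>. w y \<bullet> (grad \<phi> y - exp (- 1) *\<^sub>R newton_kernel (y - \<epsilon> *\<^sub>R x)))
      = (LINT y|lebesgue_on \<Omega>. w y \<bullet> grad \<phi> y) - (LINT y|lebesgue_on \<Omega>. w y \<bullet> (exp (- 1) *\<^sub>R newton_kernel (y - \<epsilon> *\<^sub>R x)))"
    unfolding inner_diff_right
    by (rule Bochner_Integration.integral_diff) (use Lp_Hoelder(1)[OF _ r(1,3) w g] Lp_Hoelder(1)[OF _ r(1,3) w k] p in auto)
  also have "(LINT y|lebesgue_on \<Omega>. w y \<bullet> (exp (- 1) *\<^sub>R newton_kernel (y - \<epsilon> *\<^sub>R x))) = 0"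
    using W1p_0_kernel_orthogonal[OF p u \<Omega>o sub' _ xn] \<epsilon> by (simp add: w_def)
  finally have "\<bar>LINT y|lebesgue_on (ball 0 1). d y * \<phi> y\<bar>
      = \<bar>LINT y|lebesgue_on \<Omega>. w y \<bullet> (grad \<phi> y - exp (- 1) *\<^sub>R newton_kernel (y - \<epsilon> *\<^sub>R x))\<bar>"
    using eq by simp
  also have "\<dots> \<le> Lp_norm p \<Omega> w * Lp_norm r \<Omega> (\<lambda>y. grad \<phi> y - exp (- 1) *\<^sub>R newton_kernel (y - \<epsilon> *\<^sub>R x))"
    using Lp_Hoelder(2)[OF _ r(1,3) w Lp_diff[OF _ g k]] p r by simp
  also have "\<dots> \<le> Lp_norm p \<Omega> w * truncation_error r (2 * \<epsilon>) powr (1 / r)"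
    unfolding \<phi>_def using r \<epsilon>
    by (intro mult_left_mono Lp_norm_truncation_le[OF _ r(2) _ \<Omega>s sub']) (auto simp: Lp_norm_def)
  finally show ?thesis by (simp add: r_def \<phi>_def w_def \<Omega>_def)
qed

lemma Lp_ball_integrable:
  assumes "q \<ge> 1" "d \<in> Lp q (ball 0 1)"
  shows "integrable (lebesgue_on (ball 0 1)) d"
proof (rule Bochner_Integration.integrable_bound)
  interpret finite_measure "lebesgue_on (ball (0::'a) 1)"
    by (rule finite_measure_lebesgue_on) simp
  show "integrable (lebesgue_on (ball 0 1)) (\<lambda>x. 1 + norm (d x) powr q)"
    using assms(2) by (simp add: Lp_def)
  show "d \<in> borel_measurable (lebesgue_on (ball 0 1))" using assms(2) by (simp add: Lp_def)
  have "norm (d x) \<le> 1 + norm (d x) powr q" for x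
  proof (cases "norm (d x) \<le> 1")
    case False
    then have "norm (d x) powr 1 \<le> norm (d x) powr q" using assms(1) by (intro powr_mono) auto
    then show ?thesis using False by simp
  qed (smt (verit) powr_ge_zero)
  then show "AE x in lebesgue_on (ball 0 1). norm (d x) \<le> norm (1 + norm (d x) powr q)"
    by (intro AE_I2) (smt (verit) real_norm_def)
qed

theorem theorem1p4:
  fixes T :: "(real^3) set" and p q :: real
    and f :: "real^3 \<Rightarrow> real^3" and div_f :: "real^3 \<Rightarrow> real"
    and u :: "real \<Rightarrow> real^3 \<Rightarrow> real"
  assumes "closed_Lipschitz_domain T" and "T \<subseteq> ball 0 1"
    and "p > 3" and "f \<in> Lp p (ball 0 1)"
    and "q > 3 / 2" and "div_f \<in> Lp q (ball 0 1)"
    and "has_distributional_divergence (ball 0 1) f div_f"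
    and "(LINT y|lebesgue_on (ball 0 1). (1 / norm y - 1) * div_f y) \<noteq> 0"
    and "\<forall>\<^sub>F \<epsilon> in at_right 0. weak_solution p (perforated_ball T \<epsilon>) f (u \<epsilon>)"
  shows "Liminf (at_right 0)
           (\<lambda>\<epsilon>. ereal (Lp_norm p (perforated_ball T \<epsilon>) (weak_grad (perforated_ball T \<epsilon>) (u \<epsilon>)))) = \<infinity>"
proof -
  define r where "r = p / (p - 1)"
  have r: "r > 1" "2 * r < 3" using assms(3) by (auto simp: r_def field_simps)
  define N where "N \<epsilon> = Lp_norm p (perforated_ball T \<epsilon>) (weak_grad (perforated_ball T \<epsilon>) (u \<epsilon>))" for \<epsilon>
  \<comment> \<open>A domain is nonempty, so a point of \<open>T\<close> can be fixed once for all
    \<epsilon>; its dilates stay in the holes and tend to 0.\<close>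
  obtain U where "U \<noteq> {}" "T = closure U"
    using assms(1) by (auto simp: closed_Lipschitz_domain_def)
  then obtain x where T: "closed T" "x \<in> T"
    using closure_subset by blast
  have nx: "norm x < 1" using T(2) assms(2) by auto
  define I where "I \<epsilon> = (LINT y|lebesgue_on (ball 0 1). div_f y * bump (2 * \<epsilon>) (\<epsilon> *\<^sub>R x) y)" for \<epsilon>
  define J where "J \<epsilon> = truncation_error r (2 * \<epsilon>) powr (1 / r)" for \<epsilon>
  define c where "c = exp (- 1) * (LINT y|lebesgue_on (ball 0 1). (1 / norm y - 1) * div_f y)"
  have c: "\<bar>c\<bar> > 0" using assms(8) by (simp add: c_def)
  \<comment> \<open>A non-integrable function has Bochner integral 0 by convention, so a nonzero
    integral already implies integrability.\<close>
  have Gd: "integrable (lebesgue_on (ball 0 1)) (\<lambda>y. (1 / norm y - 1) * div_f y)"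
    using assms(8) not_integrable_integral_eq by blast
  have d: "integrable (lebesgue_on (ball 0 1)) div_f"
    using Lp_ball_integrable[of q] assms(5,6) by simp
  have bound: "\<forall>\<^sub>F \<epsilon> in at_right 0. \<bar>I \<epsilon>\<bar> \<le> N \<epsilon> * J \<epsilon>"
  proof -
    have "\<forall>\<^sub>F \<epsilon> in at_right (0::real). 0 < \<epsilon> \<and> \<epsilon> \<le> 1 / 2"
      unfolding eventually_at_right_field by (intro exI[of _ "1/2"]) auto
    with assms(9) show ?thesis
      unfolding I_def N_def J_def r_def
      by eventually_elim (rule weak_solution_bump_le[OF T(1) assms(2,3,7) _ _ _ T(2)]; simp)
  qed
  have lim: "(\<lambda>n. I (E n)) \<longlonglongrightarrow> c" "(\<lambda>n. J (E n)) \<longlonglongrightarrow> 0"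
    if E: "\<And>n. 0 < E n" "\<And>n. E n \<le> 1 / 2" "E \<longlonglongrightarrow> 0" for E
  proof -
    show "(\<lambda>n. I (E n)) \<longlonglongrightarrow> c"
      unfolding I_def c_def by (rule tendsto_bump_integral[OF d Gd _ E(3)]) (use E(1) mult_strict_left_mono[OF nx E(1)] in \<open>simp add: abs_of_pos\<close>)
    have "(\<lambda>n. 2 * E n) \<longlonglongrightarrow> 0" using tendsto_mult_left[OF E(3), of 2] by simp
    moreover have "0 < 2 * E n" "2 * E n \<le> 1" for n using E(1,2)[of n] by linarith+
    ultimately have "(\<lambda>n. truncation_error r (2 * E n)) \<longlonglongrightarrow> 0"
      using r by (intro tendsto_truncation_error) auto
    moreover have "truncation_error r \<rho> \<ge> 0" for \<rho>
      unfolding truncation_error_def by (intro Bochner_Integration.integral_nonneg_AE AE_I2) simp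
    ultimately have "(\<lambda>n. truncation_error r (2 * E n) powr (1 / r)) \<longlonglongrightarrow> 0 powr (1 / r)"
      using r by (intro tendsto_powr2) auto
    then show "(\<lambda>n. J (E n)) \<longlonglongrightarrow> 0" using r by (simp add: J_def)
  qed
  \<comment> \<open>Divergence to infinity is shown, not only of the lower limit. It is reduced to
    sequences because dominated convergence is applied along them.\<close>
  have "\<forall>\<^sub>F \<epsilon> in at_right 0. C < N \<epsilon>" for C
  proof (rule sequentially_imp_eventually_at_right[of 0 "1/2"])
    fix E :: "nat \<Rightarrow> real"
    assume E: "\<And>n. 0 < E n" "\<And>n. E n < 1 / 2" "E \<longlonglongrightarrow> 0"
    have lims: "(\<lambda>n. I (E n)) \<longlonglongrightarrow> c" "(\<lambda>n. J (E n)) \<longlonglongrightarrow> 0"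
      using lim[of E] E by (auto intro: less_imp_le)
    \<comment> \<open>If N \<le> C, then |I| \<le> N J \<le> (|C| + 1) J; the right-hand side tends
      to 0 while |I| tends to |c| > 0. Replacing C by |C| + 1 gives a nonnegative constant above
      C.\<close>
    have "(\<lambda>n. \<bar>I (E n)\<bar> - (\<bar>C\<bar> + 1) * J (E n)) \<longlonglongrightarrow> \<bar>c\<bar> - (\<bar>C\<bar> + 1) * 0"
      by (intro tendsto_intros lims)
    then have "\<forall>\<^sub>F n in sequentially. 0 < \<bar>I (E n)\<bar> - (\<bar>C\<bar> + 1) * J (E n)"
      using c by (intro order_tendstoD(1)) auto
    moreover have "\<forall>\<^sub>F n in sequentially. \<bar>I (E n)\<bar> \<le> N (E n) * J (E n)"
    proof (rule eventually_compose_filterlim[OF bound])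
      have "E n \<noteq> 0" for n using E(1)[of n] by simp
      then show "filterlim E (at_right 0) sequentially"
        using E by (auto simp: filterlim_at)
    qed
    ultimately show "\<forall>\<^sub>F n in sequentially. C < N (E n)"
    proof eventually_elim
      case (elim n)
      have "J (E n) \<ge> 0" by (simp add: J_def)
      show ?case
      proof (rule ccontr)
        assume "\<not> C < N (E n)"
        then have "N (E n) * J (E n) \<le> (\<bar>C\<bar> + 1) * J (E n)"
          using \<open>J (E n) \<ge> 0\<close> by (intro mult_right_mono) auto
        then show False using elim by linarith
      qed
    qed
  qed simp
  then have "((\<lambda>\<epsilon>. ereal (N \<epsilon>)) \<longlongrightarrow> \<infinity>) (at_right 0)"
    by (simp add: tendsto_PInfty)
  then show ?thesis
    unfolding N_def by (intro lim_imp_Liminf trivial_limit_at_right_real)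
qed

end
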